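(* Let $p$ be a prime number. Fix $m\ge 1$ and let $E_m(x)=\sum_{i=0}^m \frac{x^i}{i!}$ denote the truncated exponential polynomial of degree $m$. Let $f(x) \in \mathbb{Q}[x]$ be a polynomial of degree $d$ with leading coefficient $a_d$ such that $\nu_p(a_d)=0$ and $f(x) \equiv a_d x^d \pmod{p}$. If $d$ is coprime to $m!$, then $f$ is dynamically irreducible at $E_m$.
   Context: $\nu_p$ denotes the $p$-adic valuation on $\mathbb{Q}$. The congruence $f(x)\equiv a_dx^d\pmod p$ for $f(x)=\sum_{i=0}^d a_i x^i \in\mathbb{Q}[x]$ means $\nu_p(a_i)>0$ for all $0\le i<d$ (with $\nu_p(0)=+\infty$). $f^n$ denotes the $n$-th iterate (under composition) of $f$, with $f^0(x)=x$. For $g\in\mathbb{Q}[x]$, $f$ is said to be dynamically irreducible at $g$ if $g\circ f^n$ is irreducible over $\mathbb{Q}$ for all $n\ge 0$.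
   Formalization: The formal theorem adds the hypothesis p ≤ m (i.e. p divides m!); without it the claim is false: for p = 2, m = 1, f = x^2 - 2 all hypotheses hold, but E_1(f(x)) = x^2 - 1 = (x-1)(x+1). *)

theory Defs
  imports
    Complex_Main
    "HOL-Computational_Algebra.Computational_Algebra"
    "HOL-Library.Extended"
begin

text \<open>
  The \<open>p\<close>-adic valuation on the rationals. Here \<open>quotient_of x\<close> is the pair (numerator,
  denominator) of \<open>x\<close> in lowest terms.
\<close>

definition padic_val :: "nat \<Rightarrow> rat \<Rightarrow> int extended" where
  "padic_val p x =
     (if x = 0 then Pinf
      else Fin (int (multiplicity (int p) (fst (quotient_of x)))
              - int (multiplicity (int p) (snd (quotient_of x)))))"

text \<open>
  \<open>f\<close> is congruent modulo \<open>p\<close> to its leading monomial; the leading coefficient itself is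
  not constrained.
\<close>

definition cong_lead_monom :: "nat \<Rightarrow> rat poly \<Rightarrow> bool" where
  "cong_lead_monom p f \<longleftrightarrow> (\<forall>i<degree f. padic_val p (coeff f i) > 0)"

definition poly_iterate :: "'a::comm_semiring_1 poly \<Rightarrow> nat \<Rightarrow> 'a poly" where
  "poly_iterate f n = ((\<lambda>h. pcompose f h) ^^ n) [:0, 1:]"

definition dynamically_irreducible_at :: "rat poly \<Rightarrow> rat poly \<Rightarrow> bool" where
  "dynamically_irreducible_at f g \<longleftrightarrow> (\<forall>n. irreducible (pcompose g (poly_iterate f n)))"

definition trunc_exp :: "nat \<Rightarrow> rat poly" where
  "trunc_exp m = (\<Sum>i\<le>m. monom (1 / fact i) i)"

text \<open>
  Dynamical irreducibility of \<open>f\<close> at the truncated exponential polynomial of degree \<open>m\<close>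
  needs \<open>p \<le> m\<close>. For \<open>p = 2\<close>, \<open>m = 1\<close> and \<open>f = x^2 - 2\<close> all the other hypotheses hold,
  but \<open>1 + f = (x - 1) (x + 1)\<close>.
\<close>

lemma trunc_exp_counterexample:
  defines "f \<equiv> [:-2, 0, 1:] :: rat poly"
  shows "degree f = 2" "padic_val 2 (lead_coeff f) = 0" "cong_lead_monom 2 f"
    "coprime (degree f) (fact 1)" "\<not> dynamically_irreducible_at f (trunc_exp 1)"
proof -
  show deg: "degree f = 2"
    by (simp add: f_def)
  show "padic_val 2 (lead_coeff f) = 0"
    by (simp add: f_def padic_val_def zero_extended_def)
  have "quotient_of (-2 :: rat) = (-2, 1)"
    by (simp add: quotient_of_number)
  moreover have "multiplicity 2 (2 :: int) = 1"
    by (rule multiplicity_self) auto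
  ultimately have "padic_val 2 (-2) = Fin 1"
    by (simp add: padic_val_def)
  then show "cong_lead_monom 2 f"
    unfolding cong_lead_monom_def deg
    by (auto simp: f_def zero_extended_def padic_val_def less_2_cases_iff)
  show "coprime (degree f) (fact 1)"
    by simp
  have "trunc_exp 1 = [:1, 1:]"
    by (simp add: trunc_exp_def monom_altdef)
  then have "pcompose (trunc_exp 1) (poly_iterate f 1) = [:-1, 1:] * [:1, 1:]"
    by (simp add: poly_iterate_def f_def pcompose_pCons)
  moreover have "\<not> irreducible ([:-1, 1:] * [:1, 1:] :: rat poly)"
    proof
    assume "irreducible ([:-1, 1:] * [:1, 1:] :: rat poly)"
    then have "is_unit [:-1, 1 :: rat:] \<or> is_unit [:1, 1 :: rat:]"
      by (rule irreducibleD) (rule refl)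
    then show False
      by (auto simp: is_unit_poly_iff)
  qed
  ultimately show "\<not> dynamically_irreducible_at f (trunc_exp 1)"
    unfolding dynamically_irreducible_at_def by metis
qed

end

theory Submission
  imports "Jordan_Normal_Form.Char_Poly" "HOL-Computational_Algebra.Field_as_Ring" Defs
begin

text \<open>
  Let \<open>M = m! E\<^sub>m\<close>, \<open>\<phi> = f\<^sup>n\<close> and \<open>D = d\<^sup>n\<close>, so that \<open>\<phi> = A x\<^sup>D + p w\<close> with \<open>A\<close> a \<open>p\<close>-adic unit
  and \<open>w\<close> a \<open>p\<close>-integral polynomial. Following Coleman, the Newton polygons of \<open>M\<close> at all primes
  dividing \<open>m\<close> show that \<open>M\<close> is irreducible. Let \<open>G\<close> be a monic factor of \<open>M \<circ> \<phi>\<close> of degree \<open>r > 0\<close>.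
  The characteristic polynomial of multiplication by \<open>\<phi>\<close> on \<open>\<rat>[x]/G\<close> is a power \<open>M\<^sup>j\<close>, so \<open>r = m j\<close>
  and the norm of \<open>\<phi>\<close> is \<open>\<plusminus> m!\<^sup>j\<close>. Every root of \<open>M\<close> has \<open>p\<close>-adic valuation less than 1, so modulo \<open>G\<close>
  we have \<open>A x\<^sup>D = \<phi> (1 - \<eta>)\<close> with \<open>\<eta> = p w / \<phi>\<close> topologically nilpotent, and the norm of \<open>1 - \<eta>\<close>
  is a \<open>p\<close>-adic unit. Comparing valuations of norms, \<open>D\<close> divides \<open>j v\<^sub>p(m!)\<close>. As \<open>0 < v\<^sub>p(m!) < m\<close>, the
  number \<open>D\<close> is coprime to \<open>v\<^sub>p(m!)\<close>, hence divides \<open>j\<close>, and \<open>r \<ge> m D = deg (M \<circ> \<phi>)\<close>.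
\<close>

subsection \<open>The \<open>p\<close>-adic valuation on rational numbers and polynomials\<close>

text \<open>Integer-valued, so that linear arithmetic applies; the value at 0 is the default 0, not
  infinity.\<close>

definition pval :: "nat \<Rightarrow> rat \<Rightarrow> int" where
  "pval p x = int (multiplicity (int p) (fst (quotient_of x)))
            - int (multiplicity (int p) (snd (quotient_of x)))"

text \<open>As a lower bound, 0 counts as having infinite valuation, so sums need no case
  distinctions.\<close>

definition vge :: "nat \<Rightarrow> int \<Rightarrow> rat \<Rightarrow> bool" where
  "vge p k x \<longleftrightarrow> x = 0 \<or> k \<le> pval p x"

text \<open>This bounds the Gauss valuation of \<open>f\<close> from below.\<close>

definition poly_vge :: "nat \<Rightarrow> int \<Rightarrow> rat poly \<Rightarrow> bool" where
  "poly_vge p k f \<longleftrightarrow> (\<forall>i. vge p k (coeff f i))"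

lemma padic_val_eq: "padic_val p x = (if x = 0 then Pinf else Fin (pval p x))"
  by (simp add: padic_val_def pval_def)

lemma vge_0 [simp]: "vge p k 0"
  by (simp add: vge_def)

lemma vge_mono: "vge p k x \<Longrightarrow> l \<le> k \<Longrightarrow> vge p l x"
  by (auto simp: vge_def)

lemma poly_vge_0 [simp]: "poly_vge p k 0"
  by (simp add: poly_vge_def)

lemma poly_vge_mono: "poly_vge p k f \<Longrightarrow> l \<le> k \<Longrightarrow> poly_vge p l f"
  by (auto simp: poly_vge_def intro: vge_mono)

context
  fixes p :: nat
  assumes prime_p: "prime p"
begin

lemma prime_elem_int: "prime_elem (int p)"
  using prime_p by auto

lemma pval_fract:
  assumes "a \<noteq> 0" "b \<noteq> 0"
  shows "pval p (of_int a / of_int b) = int (multiplicity (int p) a) - int (multiplicity (int p) b)"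
proof -
  define x where "x = (of_int a / of_int b :: rat)"
  obtain u v where uv: "quotient_of x = (u, v)"
    by fastforce
  have v: "v > 0" and x: "x = of_int u / of_int v"
    using quotient_of_denom_pos[OF uv] quotient_of_div[OF uv] by auto
  have "x \<noteq> 0"
    using assms by (simp add: x_def)
  with x have u: "u \<noteq> 0"
    by auto
  have "(of_int (a * v) :: rat) = of_int (u * b)"
    using x v assms unfolding x_def by (simp add: field_simps)
  then have "a * v = u * b"
    using of_int_eq_iff by blast
  then have "multiplicity (int p) a + multiplicity (int p) v
           = multiplicity (int p) u + multiplicity (int p) b"
    using prime_elem_multiplicity_mult_distrib[OF prime_elem_int] assms u v
    by (metis less_irrefl)
  then show ?thesis
    unfolding x_def[symmetric] pval_def uv by simp
qed

lemma rat_fractE: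
  fixes x :: rat
  assumes "x \<noteq> 0"
  obtains a b :: int where "x = of_int a / of_int b" "a \<noteq> 0" "b \<noteq> 0"
proof -
  obtain u v where uv: "quotient_of x = (u, v)"
    by fastforce
  show thesis
    using that[of u v] quotient_of_denom_pos[OF uv] quotient_of_div[OF uv] assms by auto
qed

lemma pval_mult: "x \<noteq> 0 \<Longrightarrow> y \<noteq> 0 \<Longrightarrow> pval p (x * y) = pval p x + pval p y"
proof -
  assume "x \<noteq> 0" "y \<noteq> 0"
  then obtain a b c d where *: "x = of_int a / of_int b" "y = of_int c / of_int d"
    "a \<noteq> 0" "b \<noteq> 0" "c \<noteq> 0" "d \<noteq> 0"
    by (metis rat_fractE)
  have "x * y = of_int (a * c) / of_int (b * d)"
    using * by simp
  then show ?thesis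
    using * pval_fract[of "a * c" "b * d"] pval_fract[of a b] pval_fract[of c d]
    by (simp add: prime_elem_multiplicity_mult_distrib[OF prime_elem_int])
qed

lemma pval_of_int: "pval p (of_int a) = int (multiplicity (int p) a)"
  by (cases "a = 0") (use pval_fract[of a 1] in \<open>auto simp: pval_def\<close>)

lemma pval_of_nat: "pval p (of_nat a) = int (multiplicity p a)"
proof -
  have "multiplicity (int p) (int a) = multiplicity p a"
    unfolding multiplicity_def by (simp flip: of_nat_power)
  then show ?thesis
    using pval_of_int[of "int a"] by simp
qed

lemma pval_1 [simp]: "pval p 1 = 0"
  using pval_of_int[of 1] by simp

lemma pval_p: "pval p (of_nat p) = 1"
  using prime_p by (simp add: pval_of_nat)

lemma pval_minus [simp]: "pval p (- x) = pval p x"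
proof (cases "x = 0")
  case False
  have "pval p (-1) = 0"
    using pval_of_int[of "-1"] by simp
  then show ?thesis
    using pval_mult[of "-1" x] False by simp
qed simp

lemma pval_power: "x \<noteq> 0 \<Longrightarrow> pval p (x ^ n) = int n * pval p x"
  by (induction n) (simp_all add: pval_mult algebra_simps)

lemma pval_divide:
  assumes "x \<noteq> 0" "y \<noteq> 0"
  shows "pval p (x / y) = pval p x - pval p y"
  using pval_mult[of "x / y" y] assms by simp

lemma vge_mult: "vge p k x \<Longrightarrow> vge p l y \<Longrightarrow> vge p (k + l) (x * y)"
  by (cases "x = 0 \<or> y = 0") (auto simp: vge_def pval_mult)

lemma vge_of_int [simp]: "vge p 0 (of_int a)"
  by (simp add: vge_def pval_of_int)

lemma vge_minus [simp]: "vge p k (- x) \<longleftrightarrow> vge p k x"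
  by (simp add: vge_def)

text \<open>Writing \<open>x\<close> as \<open>a / b\<close>, the full power of \<open>p\<close> in
  \<open>b\<close> also divides \<open>a\<close>, hence \<open>a + b\<close>. This is the
  ultrametric inequality with one summand normalised to 1.\<close>

lemma vge_add_aux:
  assumes "x \<noteq> 0" "0 \<le> pval p x"
  shows "vge p 0 (1 + x)"
proof -
  obtain a b where ab: "x = of_int a / of_int b" "a \<noteq> 0" "b \<noteq> 0"
    using rat_fractE[OF assms(1)] .
  have le: "multiplicity (int p) b \<le> multiplicity (int p) a"
    using assms(2) pval_fract[OF ab(2,3)] by (simp add: ab)
  have sum: "1 + x = of_int (a + b) / of_int b"
    using ab by (simp add: field_simps)
  show ?thesis
  proof (cases "a + b = 0")
    case False
    have "int p ^ multiplicity (int p) b dvd a + b"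
      using le by (simp add: multiplicity_dvd multiplicity_dvd' dvd_add)
    then have "multiplicity (int p) b \<le> multiplicity (int p) (a + b)"
      using False prime_elem_int by (intro multiplicity_geI) auto
    then show ?thesis
      unfolding vge_def sum using pval_fract[of "a + b" b] False ab by simp
  qed (simp add: sum vge_def)
qed

lemma vge_add:
  assumes "vge p k x" "vge p k y"
  shows "vge p k (x + y)"
proof -
  \<comment> \<open>Factoring out the summand of smaller valuation reduces to a sum
    \<open>1 + x\<close>.\<close>
  have *: "vge p k (u + v)" if "u \<noteq> 0" "v \<noteq> 0" "k \<le> pval p u" "pval p u \<le> pval p v" for u v
  proof -
    have "vge p (pval p u) (u * (1 + v / u))"
      using vge_mult[of "pval p u" u 0 "1 + v / u"] vge_add_aux[of "v / u"] that
      by (simp add: pval_divide vge_def)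
    moreover have "u * (1 + v / u) = u + v"
      using that by (simp add: field_simps)
    ultimately show ?thesis
      using that vge_mono by metis
  qed
  show ?thesis
  proof (cases "x = 0 \<or> y = 0")
    case False
    then show ?thesis
      using *[of x y] *[of y x] assms unfolding vge_def
      by (metis add.commute nle_le)
  qed (use assms in auto)
qed

lemma vge_diff: "vge p k x \<Longrightarrow> vge p k y \<Longrightarrow> vge p k (x - y)"
  using vge_add[of k x "- y"] by simp

lemma vge_sum: "(\<And>i. i \<in> A \<Longrightarrow> vge p k (g i)) \<Longrightarrow> vge p k (sum g A)"
  by (induction A rule: infinite_finite_induct) (auto intro: vge_add)

lemma vge_1 [simp]: "vge p 0 1"
  using vge_of_int[of 1] by simp

lemma vge_prod: "(\<And>i. i \<in> A \<Longrightarrow> vge p 0 (g i)) \<Longrightarrow> vge p 0 (prod g A)"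
  by (induction A rule: infinite_finite_induct) (auto intro: vge_mult[of 0 _ 0, simplified])

text \<open>Were the valuation of \<open>x + y\<close> larger, subtracting \<open>y\<close> would
  make that of \<open>x\<close> exceed itself.\<close>

lemma pval_add_unique:
  assumes "x \<noteq> 0" "vge p (pval p x + 1) y"
  shows "x + y \<noteq> 0" "pval p (x + y) = pval p x"
proof -
  have *: "\<not> vge p (pval p x + 1) (x + y)"
  proof
    assume "vge p (pval p x + 1) (x + y)"
    from vge_diff[OF this assms(2)] assms(1) show False
      by (simp add: vge_def)
  qed
  then show "x + y \<noteq> 0"
    by auto
  have "vge p (pval p x) (x + y)"
    using assms by (intro vge_add) (auto simp: vge_def)
  with * show "pval p (x + y) = pval p x"
    by (auto simp: vge_def)
qed

section \<open>Gauss valuation of sums, products, compositions and remainders\<close>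

lemma poly_vge_add: "poly_vge p k f \<Longrightarrow> poly_vge p k g \<Longrightarrow> poly_vge p k (f + g)"
  by (simp add: poly_vge_def vge_add)

lemma poly_vge_diff: "poly_vge p k f \<Longrightarrow> poly_vge p k g \<Longrightarrow> poly_vge p k (f - g)"
  by (simp add: poly_vge_def vge_diff)

lemma poly_vge_mult: "poly_vge p k f \<Longrightarrow> poly_vge p l g \<Longrightarrow> poly_vge p (k + l) (f * g)"
  by (auto simp: poly_vge_def coeff_mult intro!: vge_sum vge_mult)

lemma poly_vge_sum: "(\<And>i. i \<in> A \<Longrightarrow> poly_vge p k (g i)) \<Longrightarrow> poly_vge p k (sum g A)"
  by (induction A rule: infinite_finite_induct) (auto intro: poly_vge_add)

lemma poly_vge_const [simp]: "poly_vge p k [:c:] \<longleftrightarrow> vge p k c"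
  by (auto simp: poly_vge_def coeff_pCons split: nat.splits)

lemma poly_vge_smult: "vge p k c \<Longrightarrow> poly_vge p l f \<Longrightarrow> poly_vge p (k + l) (Polynomial.smult c f)"
  by (simp add: poly_vge_def vge_mult)

lemma poly_vge_monom: "vge p k c \<Longrightarrow> poly_vge p k (monom c n)"
  by (simp add: poly_vge_def)

lemma poly_vge_1 [simp]: "poly_vge p 0 1"
  by (simp add: one_pCons)

lemma poly_vge_power: "poly_vge p 0 f \<Longrightarrow> poly_vge p 0 (f ^ n)"
  by (induction n) (auto intro: poly_vge_mult[of 0 _ 0, simplified])

lemma poly_vge_pcompose:
  assumes "poly_vge p k f" "poly_vge p 0 g"
  shows "poly_vge p k (pcompose f g)"
proof -
  have "pcompose f g = (\<Sum>i\<le>degree f. Polynomial.smult (coeff f i) (g ^ i))"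
    by (simp add: pcompose_altdef poly_altdef coeff_map_poly mult.commute
          degree_map_poly)
  then show ?thesis
    using assms poly_vge_smult[of k _ 0] poly_vge_power
    by (auto intro!: poly_vge_sum simp: poly_vge_def[of _ _ f])
qed

text \<open>Long division by a monic divisor only multiplies and subtracts coefficients, so no
  denominators arise.\<close>

lemma poly_vge_mod:
  assumes "lead_coeff g = 1" "poly_vge p 0 g" "poly_vge p k f"
  shows "poly_vge p k (f mod g)"
  using assms(3)
proof (induction "degree f" arbitrary: f rule: less_induct)
  case less
  show ?case
  proof (cases "f = 0 \<or> degree f < degree g")
    case False
    define u where "u = monom (lead_coeff f) (degree f - degree g)"
    define f' where "f' = f - u * g"
    have g0: "g \<noteq> 0"
      using assms(1) by auto
    have u: "degree (u * g) = degree f" "coeff (u * g) (degree f) = lead_coeff f"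
      using False assms(1) g0 unfolding u_def
      by (auto simp: degree_mult_eq degree_monom_eq monom_eq_0_iff coeff_monom_mult)
    have "poly_vge p k u"
      using less.prems unfolding u_def by (intro poly_vge_monom) (simp add: poly_vge_def)
    then have f': "poly_vge p k f'"
      unfolding f'_def using poly_vge_mult[of k u 0 g] assms(2) less.prems
      by (intro poly_vge_diff) auto
    have mod: "f mod g = f' mod g"
      unfolding f'_def by (simp add: mod_diff_left_eq flip: mod_diff_right_eq)
    show ?thesis
    proof (cases "degree f' < degree f")
      case True
      with less.hyps f' mod show ?thesis
        by simp
    next
      \<comment> \<open>The degree fails to drop only for constant \<open>f\<close>, where the
        cancellation leaves 0.\<close>
      case ge: False
      have "degree f' \<le> degree f"
        unfolding f'_def using u by (intro degree_diff_le) auto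
      moreover have "coeff f' (degree f) = 0"
        unfolding f'_def using u by simp
      ultimately have "f' = 0"
        using ge by (metis leading_coeff_0_iff linorder_not_less nle_le)
      then show ?thesis
        using mod by simp
    qed
  qed (use less.prems in \<open>auto simp: mod_poly_less\<close>)
qed

end

subsection \<open>Newton polygons\<close>

text \<open>The height at which the line of slope \<open>- l\<close> through the point of index
  \<open>i\<close> meets the vertical axis.\<close>

definition newton_weight :: "nat \<Rightarrow> rat \<Rightarrow> rat poly \<Rightarrow> nat \<Rightarrow> rat" where
  "newton_weight p l g i = of_int (pval p (coeff g i)) + l * of_nat i"

text \<open>
  The index \<open>i\<close> lies on the supporting line of slope \<open>- l\<close> of the Newton polygon of \<open>g\<close>.
\<close>
definition newton_min :: "nat \<Rightarrow> rat \<Rightarrow> rat poly \<Rightarrow> nat \<Rightarrow> bool" where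
  "newton_min p l g i \<longleftrightarrow> coeff g i \<noteq> 0 \<and>
     (\<forall>j. coeff g j \<noteq> 0 \<longrightarrow> newton_weight p l g i \<le> newton_weight p l g j)"

lemma newton_min_ex:
  assumes "g \<noteq> 0"
  shows "\<exists>i. newton_min p l g i"
proof -
  let ?A = "{i. coeff g i \<noteq> 0}"
  have "finite ?A"
    using MOST_coeff_eq_0[of g] by (simp add: eventually_cofinite)
  moreover have "?A \<noteq> {}"
    using assms leading_coeff_0_iff[of g] by blast
  ultimately show ?thesis
    using ex_min_if_finite[of "newton_weight p l g ` ?A"]
    by (force simp: newton_min_def not_less)
qed

lemma finite_newton_min: "finite {i. newton_min p l g i}"
proof (rule finite_subset)
  show "{i. newton_min p l g i} \<subseteq> {..degree g}"
    by (auto simp: newton_min_def intro: le_degree)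
qed simp

lemma newton_min_less:
  assumes "newton_min p l g i" "\<not> newton_min p l g j" "coeff g j \<noteq> 0"
  shows "newton_weight p l g i < newton_weight p l g j"
  using assms by (meson newton_min_def not_less order_trans)

text \<open>The quotient is minus the slope of the segment from \<open>k\<close> to
  \<open>i\<close>. When \<open>i\<close> is a vertex, its minimum selects the edge of the Newton
  polygon that ends at \<open>i\<close>; index 0 ensures that a candidate exists.\<close>

lemma min_slope_ex:
  assumes "coeff g 0 \<noteq> (0 :: rat)" "0 < i"
  obtains j where "j < i" "coeff g j \<noteq> 0"
    "\<And>k. k < i \<Longrightarrow> coeff g k \<noteq> 0 \<Longrightarrow>
       (of_int (pval p (coeff g j) - pval p (coeff g i)) / (of_nat i - of_nat j) :: rat)
       \<le> of_int (pval p (coeff g k) - pval p (coeff g i)) / (of_nat i - of_nat k)"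
proof -
  define r :: "nat \<Rightarrow> rat" where
    "r = (\<lambda>k. of_int (pval p (coeff g k) - pval p (coeff g i)) / (of_nat i - of_nat k))"
  let ?A = "{k. k < i \<and> coeff g k \<noteq> 0}"
  have "finite ?A" "?A \<noteq> {}"
    using assms by auto
  then have "arg_min_on r ?A \<in> ?A" "\<And>k. k \<in> ?A \<Longrightarrow> r (arg_min_on r ?A) \<le> r k"
    by (rule arg_min_if_finite(1), rule arg_min_least)
  then obtain j where "j \<in> ?A" "\<And>k. k \<in> ?A \<Longrightarrow> r j \<le> r k"
    by blast
  then show thesis
    using that[of j] unfolding r_def by blast
qed

text \<open>Indices left of \<open>i\<close> lie on or above the line through \<open>i\<close> and
  \<open>j\<close> by minimality, those right of it by \<open>above\<close>, so the line supports
  the polygon.\<close>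

lemma newton_min_min_slope:
  assumes "coeff g i \<noteq> 0" "j < i" "coeff g j \<noteq> 0"
    and l: "l = of_int (pval p (coeff g j) - pval p (coeff g i)) / (of_nat i - of_nat j)"
    and min: "\<And>k. k < i \<Longrightarrow> coeff g k \<noteq> 0 \<Longrightarrow>
       l \<le> of_int (pval p (coeff g k) - pval p (coeff g i)) / (of_nat i - of_nat k)"
    and above: "\<And>k. i < k \<Longrightarrow> coeff g k \<noteq> 0 \<Longrightarrow> newton_weight p l g i \<le> newton_weight p l g k"
  shows "newton_min p l g i" "newton_min p l g j"
proof -
  have eq: "newton_weight p l g j = newton_weight p l g i"
    using assms(2) unfolding newton_weight_def l by (simp add: field_simps)
  have "newton_weight p l g i \<le> newton_weight p l g k" if "k < i" "coeff g k \<noteq> 0" for k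
    using min[OF that] that(1) unfolding newton_weight_def by (simp add: field_simps)
  then show "newton_min p l g i"
    using assms above unfolding newton_min_def by (metis nat_neq_iff order_refl)
  then show "newton_min p l g j"
    using assms eq by (simp add: newton_min_def)
qed

text \<open>Tilting the supporting line at a vertex moves it along an edge to a vertex of smaller index.\<close>
lemma dvd_newton_vertex:
  assumes g0: "coeff g 0 \<noteq> 0"
    and edge: "\<And>l i j. newton_min p l g i \<Longrightarrow> newton_min p l g j \<Longrightarrow> i < j \<Longrightarrow> N dvd j - i"
  shows "newton_min p l g i \<Longrightarrow> N dvd i"
proof (induction i arbitrary: l rule: less_induct)
  case (less i)
  show ?case
  proof (cases "i = 0")
    case False
    then obtain j where j: "j < i" "coeff g j \<noteq> 0"
      "\<And>k. k < i \<Longrightarrow> coeff g k \<noteq> 0 \<Longrightarrow>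
       (of_int (pval p (coeff g j) - pval p (coeff g i)) / (of_nat i - of_nat j) :: rat)
       \<le> of_int (pval p (coeff g k) - pval p (coeff g i)) / (of_nat i - of_nat k)"
      using min_slope_ex[OF g0, of i p] by blast
    define l' :: rat where
      "l' = of_int (pval p (coeff g j) - pval p (coeff g i)) / (of_nat i - of_nat j)"
    have gi: "coeff g i \<noteq> 0"
      using less.prems by (simp add: newton_min_def)
    have "newton_weight p l g i \<le> newton_weight p l g j"
      using less.prems j by (simp add: newton_min_def)
    then have ll: "l \<le> l'"
      using j(1) unfolding l'_def newton_weight_def by (simp add: field_simps)
    \<comment> \<open>Raising \<open>l\<close> to \<open>l'\<close> raises the weight of a larger
      index by at least as much as that of \<open>i\<close>.\<close>
    have above: "newton_weight p l' g i \<le> newton_weight p l' g k" if "i < k" "coeff g k \<noteq> 0" for k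
    proof -
      have "newton_weight p l g i \<le> newton_weight p l g k"
        using less.prems that by (simp add: newton_min_def)
      moreover have "(l' - l) * of_nat i \<le> (l' - l) * of_nat k"
        using ll that by (intro mult_left_mono) auto
      ultimately show ?thesis
        unfolding newton_weight_def by (simp add: algebra_simps)
    qed
    have "newton_min p l' g i" "newton_min p l' g j"
      using newton_min_min_slope[OF gi j(1,2) l'_def _ above] j(3) unfolding l'_def by blast+
    then have "N dvd i - j" "N dvd j"
      using edge less.IH j(1) by blast+
    then show ?thesis
      using j(1) by (metis dvd_diffD1 dvd_diff_nat less_imp_le dvd_add le_add_diff_inverse2)
  qed simp
qed

text \<open>The degree is the last vertex, and it is joined to index 0 by edges whose lengths are
  multiples of \<open>N\<close>.\<close>

lemma dvd_degree_if_dvd_newton_edges: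
  assumes g0: "coeff g 0 \<noteq> 0"
    and edge: "\<And>l i j. newton_min p l g i \<Longrightarrow> newton_min p l g j \<Longrightarrow> i < j \<Longrightarrow> N dvd j - i"
  shows "N dvd degree g"
proof (cases "degree g = 0")
  case False
  have gd: "coeff g (degree g) \<noteq> 0"
    using False by auto
  from False obtain j where j: "j < degree g" "coeff g j \<noteq> 0"
    "\<And>k. k < degree g \<Longrightarrow> coeff g k \<noteq> 0 \<Longrightarrow>
     (of_int (pval p (coeff g j) - pval p (coeff g (degree g))) / (of_nat (degree g) - of_nat j) :: rat)
     \<le> of_int (pval p (coeff g k) - pval p (coeff g (degree g))) / (of_nat (degree g) - of_nat k)"
    using min_slope_ex[OF g0, of "degree g" p] by blast
  have "newton_min p (of_int (pval p (coeff g j) - pval p (coeff g (degree g)))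
      / (of_nat (degree g) - of_nat j)) g (degree g)"
    by (rule newton_min_min_slope[OF gd j(1,2) refl j(3)]) (auto simp: coeff_eq_0)
  then show ?thesis
    using dvd_newton_vertex[OF g0, of p N] edge by blast
qed simp

section \<open>Newton polygons of products and Gauss's lemma\<close>

context
  fixes p :: nat
  assumes prime_p: "prime p"
begin

text \<open>
  If \<open>(i, j)\<close> is the only pair of minimal total weight with index sum \<open>i + j\<close>, no cancellation
  can occur in that coefficient of the product.
\<close>
lemma newton_min_mult:
  assumes i: "newton_min p l g i" and j: "newton_min p l h j"
    and uniq: "\<And>a b. a + b = i + j \<Longrightarrow> a \<noteq> i \<Longrightarrow> coeff g a \<noteq> 0 \<Longrightarrow> coeff h b \<noteq> 0 \<Longrightarrow>
      newton_weight p l g i + newton_weight p l h j < newton_weight p l g a + newton_weight p l h b"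
  shows "newton_min p l (g * h) (i + j)"
    and "newton_weight p l (g * h) (i + j) = newton_weight p l g i + newton_weight p l h j"
proof -
  have nz: "coeff g i \<noteq> 0" "coeff h j \<noteq> 0"
    using i j by (auto simp: newton_min_def)
  define R where "R = (\<Sum>a\<in>{..i + j} - {i}. coeff g a * coeff h (i + j - a))"
  have coeff: "coeff (g * h) (i + j) = coeff g i * coeff h j + R"
    unfolding coeff_mult R_def by (subst sum.remove[of _ i]) auto
  have "vge p (pval p (coeff g i * coeff h j) + 1) R"
    unfolding R_def
  proof (rule vge_sum[OF prime_p])
    fix a assume a: "a \<in> {..i + j} - {i}"
    show "vge p (pval p (coeff g i * coeff h j) + 1) (coeff g a * coeff h (i + j - a))"
    proof (cases "coeff g a = 0 \<or> coeff h (i + j - a) = 0")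
      case False
      have "newton_weight p l g i + newton_weight p l h j
          < newton_weight p l g a + newton_weight p l h (i + j - a)"
        using a False by (intro uniq) auto
      moreover have "of_nat a + of_nat (i + j - a) = (of_nat i + of_nat j :: rat)"
        using a by (simp flip: of_nat_add)
      then have "l * of_nat a + l * of_nat (i + j - a) = l * of_nat i + l * of_nat j"
        by (simp flip: distrib_left)
      ultimately have "of_int (pval p (coeff g i) + pval p (coeff h j))
          < (of_int (pval p (coeff g a) + pval p (coeff h (i + j - a))) :: rat)"
        unfolding newton_weight_def by simp
      then have "pval p (coeff g i) + pval p (coeff h j)
          < pval p (coeff g a) + pval p (coeff h (i + j - a))"
        by (simp only: of_int_less_iff)
      then show ?thesis
        using False nz by (simp add: vge_def pval_mult[OF prime_p])
    qed auto
  qed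
  from pval_add_unique[OF prime_p _ this] nz
  have c0: "coeff (g * h) (i + j) \<noteq> 0"
    and val: "pval p (coeff (g * h) (i + j)) = pval p (coeff g i) + pval p (coeff h j)"
    by (simp_all add: coeff pval_mult[OF prime_p])
  show eq: "newton_weight p l (g * h) (i + j) = newton_weight p l g i + newton_weight p l h j"
    unfolding newton_weight_def val by (simp add: algebra_simps)
  have "newton_weight p l g i + newton_weight p l h j \<le> newton_weight p l (g * h) n"
    if n: "coeff (g * h) n \<noteq> 0" for n
  proof -
    \<comment> \<open>\<open>vge\<close> takes an integer bound; rounding up is harmless because
      valuations are integers.\<close>
    define k where "k = \<lceil>newton_weight p l g i + newton_weight p l h j - l * of_nat n\<rceil>"
    have "vge p k (coeff (g * h) n)"
      unfolding coeff_mult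
    proof (rule vge_sum[OF prime_p])
      fix a assume a: "a \<in> {..n}"
      show "vge p k (coeff g a * coeff h (n - a))"
      proof (cases "coeff g a = 0 \<or> coeff h (n - a) = 0")
        case False
        have "newton_weight p l g i + newton_weight p l h j
            \<le> newton_weight p l g a + newton_weight p l h (n - a)"
          using i j False by (intro add_mono) (auto simp: newton_min_def)
        moreover have "of_nat a + of_nat (n - a) = (of_nat n :: rat)"
          using a by (simp flip: of_nat_add)
        then have "l * of_nat a + l * of_nat (n - a) = l * of_nat n"
          by (simp flip: distrib_left)
        ultimately have "k \<le> pval p (coeff g a) + pval p (coeff h (n - a))"
          unfolding k_def newton_weight_def by (simp add: ceiling_le_iff)
        then show ?thesis
          using False by (simp add: vge_def pval_mult[OF prime_p])
      qed auto
    qed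
    then have "k \<le> pval p (coeff (g * h) n)"
      using n by (simp add: vge_def)
    then show ?thesis
      unfolding k_def ceiling_le_iff newton_weight_def[of _ _ "g * h"] by linarith
  qed
  then show "newton_min p l (g * h) (i + j)"
    using c0 eq by (simp add: newton_min_def)
qed

text \<open>Any other pair with the same index sum uses an index below one of the two minima, whose
  weight is strictly larger.\<close>

lemma newton_min_Min:
  assumes "g \<noteq> 0" "h \<noteq> 0"
  shows "newton_min p l (g * h) (Min {i. newton_min p l g i} + Min {i. newton_min p l h i})"
proof -
  let ?A = "\<lambda>g. {i. newton_min p l g i}"
  have ne: "?A g \<noteq> {}" "?A h \<noteq> {}"
    using newton_min_ex assms by auto
  have min: "newton_min p l g (Min (?A g))" "newton_min p l h (Min (?A h))"
    using Min_in[OF finite_newton_min ne(1)] Min_in[OF finite_newton_min ne(2)] by auto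
  show ?thesis
  proof (rule newton_min_mult[OF min])
    fix a b assume ab: "a + b = Min (?A g) + Min (?A h)" "a \<noteq> Min (?A g)" "coeff g a \<noteq> 0" "coeff h b \<noteq> 0"
    have le: "newton_weight p l g (Min (?A g)) \<le> newton_weight p l g a"
        "newton_weight p l h (Min (?A h)) \<le> newton_weight p l h b"
      using min ab by (auto simp: newton_min_def)
    from ab consider "a < Min (?A g)" | "b < Min (?A h)"
      by linarith
    then show "newton_weight p l g (Min (?A g)) + newton_weight p l h (Min (?A h))
        < newton_weight p l g a + newton_weight p l h b"
    proof cases
      case 1
      then have "\<not> newton_min p l g a"
        using Min_le[OF finite_newton_min, of a] by (auto simp: not_le[symmetric])
      from newton_min_less[OF min(1) this ab(3)] le show ?thesis
        by linarith
    next
      case 2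
      then have "\<not> newton_min p l h b"
        using Min_le[OF finite_newton_min, of b] by (auto simp: not_le[symmetric])
      from newton_min_less[OF min(2) this ab(4)] le show ?thesis
        by linarith
    qed
  qed
qed

text \<open>The largest indices are likewise without competitor. For \<open>l = 0\<close> the weight
  equation is the additivity of the Gauss valuation.\<close>

lemma newton_min_Max:
  assumes "g \<noteq> 0" "h \<noteq> 0"
  shows "newton_min p l (g * h) (Max {i. newton_min p l g i} + Max {i. newton_min p l h i})"
    and "newton_weight p l (g * h) (Max {i. newton_min p l g i} + Max {i. newton_min p l h i})
      = newton_weight p l g (Max {i. newton_min p l g i}) + newton_weight p l h (Max {i. newton_min p l h i})"
proof -
  let ?A = "\<lambda>g. {i. newton_min p l g i}"
  have ne: "?A g \<noteq> {}" "?A h \<noteq> {}"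
    using newton_min_ex assms by auto
  have max: "newton_min p l g (Max (?A g))" "newton_min p l h (Max (?A h))"
    using Max_in[OF finite_newton_min ne(1)] Max_in[OF finite_newton_min ne(2)] by auto
  have uniq: "newton_weight p l g (Max (?A g)) + newton_weight p l h (Max (?A h))
        < newton_weight p l g a + newton_weight p l h b"
    if ab: "a + b = Max (?A g) + Max (?A h)" "a \<noteq> Max (?A g)" "coeff g a \<noteq> 0" "coeff h b \<noteq> 0" for a b
  proof -
    have le: "newton_weight p l g (Max (?A g)) \<le> newton_weight p l g a"
        "newton_weight p l h (Max (?A h)) \<le> newton_weight p l h b"
      using max ab by (auto simp: newton_min_def)
    from ab consider "a > Max (?A g)" | "b > Max (?A h)"
      by linarith
    then show ?thesis
    proof cases
      case 1
      then have "\<not> newton_min p l g a"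
        using Max_ge[OF finite_newton_min, of a] by (auto simp: not_le[symmetric])
      from newton_min_less[OF max(1) this ab(3)] le show ?thesis
        by linarith
    next
      case 2
      then have "\<not> newton_min p l h b"
        using Max_ge[OF finite_newton_min, of b] by (auto simp: not_le[symmetric])
      from newton_min_less[OF max(2) this ab(4)] le show ?thesis
        by linarith
    qed
  qed
  show "newton_min p l (g * h) (Max (?A g) + Max (?A h))"
    "newton_weight p l (g * h) (Max (?A g) + Max (?A h))
      = newton_weight p l g (Max (?A g)) + newton_weight p l h (Max (?A h))"
    using newton_min_mult[OF max uniq] by blast+
qed

text \<open>The smallest and the largest minimal indices both add up, so an edge of a factor leaves
  an edge of the same slope in the product.\<close>

lemma newton_edge_mult:
  assumes "newton_min p l g i" "newton_min p l g j" "i < j" "h \<noteq> 0"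
  obtains i' j' where "newton_min p l (g * h) i'" "newton_min p l (g * h) j'" "i' < j'"
proof -
  have g: "g \<noteq> 0"
    using assms(1) by (auto simp: newton_min_def)
  have "Min {i. newton_min p l g i} \<le> i" "j \<le> Max {i. newton_min p l g i}"
    using assms Min_le[OF finite_newton_min] Max_ge[OF finite_newton_min] by auto
  moreover have "Min {i. newton_min p l h i} \<le> Max {i. newton_min p l h i}"
    using newton_min_ex[OF assms(4)] Min_le[OF finite_newton_min] Max_ge[OF finite_newton_min]
    by (metis mem_Collect_eq order_trans)
  ultimately show thesis
    using that[OF newton_min_Min[OF g assms(4)] newton_min_Max(1)[OF g assms(4)]] assms(3)
    by linarith
qed

text \<open>Minimal weights for slope 0 add up. That of \<open>g * h\<close> is at least 0, and that
  of \<open>h\<close> is at most 0 because its leading coefficient is a unit at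
  \<open>p\<close>.\<close>

lemma monic_factor_integral:
  assumes "poly_vge p 0 (g * h)" "pval p (lead_coeff (g * h)) = 0" "lead_coeff g = 1" "h \<noteq> 0"
  shows "poly_vge p 0 g"
proof -
  let ?i = "Max {i. newton_min p 0 g i}" and ?j = "Max {i. newton_min p 0 h i}"
  have g: "g \<noteq> 0"
    using assms(3) by auto
  have "{i. newton_min p 0 g i} \<noteq> {}" "{i. newton_min p 0 h i} \<noteq> {}"
    using newton_min_ex g assms(4) by auto
  then have min: "newton_min p 0 g ?i" "newton_min p 0 h ?j"
    using Max_in[OF finite_newton_min, of p 0 g] Max_in[OF finite_newton_min, of p 0 h] by auto
  have "pval p (lead_coeff g) + pval p (lead_coeff h) = 0"
    using assms g by (simp add: lead_coeff_mult pval_mult[OF prime_p] pval_1[OF prime_p])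
  then have "pval p (lead_coeff h) = 0"
    using assms(3) by (simp add: pval_1[OF prime_p])
  then have "newton_weight p 0 h (degree h) = 0"
    by (simp add: newton_weight_def)
  moreover have "newton_weight p 0 h ?j \<le> newton_weight p 0 h (degree h)"
    using min(2) assms(4) by (simp add: newton_min_def)
  ultimately have "newton_weight p 0 h ?j \<le> 0"
    by simp
  moreover have "coeff (g * h) (?i + ?j) \<noteq> 0"
    using newton_min_Max(1)[OF g assms(4), of 0] by (simp add: newton_min_def)
  then have "newton_weight p 0 (g * h) (?i + ?j) \<ge> 0"
    using assms(1) by (auto simp: newton_weight_def poly_vge_def vge_def)
  ultimately have "newton_weight p 0 g ?i \<ge> 0"
    unfolding newton_min_Max(2)[OF g assms(4)] by linarith
  then have "newton_weight p 0 g k \<ge> 0" if "coeff g k \<noteq> 0" for k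
    using min(1) that unfolding newton_min_def by (meson order_trans)
  then show ?thesis
    by (auto simp: poly_vge_def vge_def newton_weight_def)
qed

end

subsection \<open>The truncated exponential is irreducible\<close>

text \<open>The edges of the Newton polygon of \<open>trunc_exp\<close> at \<open>q\<close> have slopes \<open>- geom q n / q ^ n\<close>.\<close>
definition geom :: "nat \<Rightarrow> nat \<Rightarrow> nat" where
  "geom q n = (\<Sum>t<n. q ^ t)"

text \<open>This is the polynomial \<open>M\<close>; clearing denominators makes it monic and
  integral.\<close>

definition monic_trunc_exp :: "nat \<Rightarrow> rat poly" where
  "monic_trunc_exp m = Polynomial.smult (fact m) (trunc_exp m)"

lemma coeff_monic_trunc_exp:
  "coeff (monic_trunc_exp m) i = (if i \<le> m then fact m / fact i else 0)"
proof -
  have "coeff (trunc_exp m) i = (\<Sum>j\<le>m. if i = j then 1 / fact j else 0)"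
    unfolding trunc_exp_def coeff_sum coeff_monom by (rule sum.cong) auto
  also have "\<dots> = (if i \<le> m then 1 / fact i else 0)"
    by (subst sum.delta') auto
  finally show ?thesis
    by (simp add: monic_trunc_exp_def)
qed

lemma degree_monic_trunc_exp: "degree (monic_trunc_exp m) = m"
proof (rule antisym)
  show "degree (monic_trunc_exp m) \<le> m"
    by (rule degree_le) (simp add: coeff_monic_trunc_exp)
  show "m \<le> degree (monic_trunc_exp m)"
    by (rule le_degree) (simp add: coeff_monic_trunc_exp)
qed

lemma lead_coeff_monic_trunc_exp: "lead_coeff (monic_trunc_exp m) = 1"
  by (simp add: degree_monic_trunc_exp coeff_monic_trunc_exp)

lemma geom_eq: "geom q n = (\<Sum>t=1..n. q ^ (n - t))"
  unfolding geom_def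
  by (rule sum.reindex_bij_witness[of _ "\<lambda>t. n - t" "\<lambda>t. n - t"]) auto

text \<open>Modulo \<open>q\<close> only the term 1 of the sum survives. Thus
  \<open>geom q n / q ^ n\<close> is in lowest terms.\<close>

lemma coprime_geom: "0 < n \<Longrightarrow> coprime (geom q n) q"
proof -
  assume "0 < n"
  then obtain k where "n = Suc k"
    by (cases n) auto
  then have "geom q n = 1 + q * geom q k"
    by (simp add: geom_def sum.lessThan_Suc_shift sum_distrib_left del: sum.lessThan_Suc)
  then show ?thesis
    by (metis coprime_1_left coprime_iff_gcd_eq_1 gcd.commute gcd_add_mult mult.commute add.commute)
qed

section \<open>Legendre's formula and valuations of factorials\<close>

context
  fixes q :: nat
  assumes prime_q: "prime q"
begin

abbreviation "fact_val n \<equiv> multiplicity q (fact n :: nat)"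

lemma fact_val_Suc: "fact_val (Suc n) = multiplicity q (Suc n) + fact_val n"
proof -
  have "prime_elem q"
    using prime_q by blast
  then show ?thesis
    unfolding fact_Suc of_nat_id
    by (rule prime_elem_multiplicity_mult_distrib) simp_all
qed

text \<open>Passing from \<open>n\<close> to \<open>Suc n\<close> raises exactly the quotients by
  those \<open>q ^ t\<close> that divide \<open>Suc n\<close>, and their number is its multiplicity.
  Powers beyond the cutoff \<open>N\<close> exceed \<open>n\<close>.\<close>

lemma legendre_fact:
  "n < q ^ Suc N \<Longrightarrow> fact_val n = (\<Sum>t=1..N. n div q ^ t)"
proof (induction n)
  case (Suc n)
  let ?v = "multiplicity q (Suc n)"
  have dvd: "q ^ t dvd Suc n \<longleftrightarrow> t \<le> ?v" for t
    using prime_q by (intro power_dvd_iff_le_multiplicity) auto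
  have "q ^ ?v \<le> Suc n"
    by (intro dvd_imp_le multiplicity_dvd) simp
  with Suc.prems have "q ^ ?v < q ^ Suc N"
    by linarith
  then have "?v \<le> N"
    using prime_gt_1_nat[OF prime_q] by (simp add: power_strict_increasing_iff less_Suc_eq_le del: power_Suc)
  then have "{t \<in> {1..N}. q ^ t dvd Suc n} = {1..?v}"
    unfolding dvd by auto
  then have "card {t \<in> {1..N}. q ^ t dvd Suc n} = ?v"
    by (simp only: card_atLeastAtMost diff_Suc_1)
  moreover have "(\<Sum>t=1..N. of_bool (P t)) = card {t \<in> {1..N}. P t}" for P
    by (simp add: of_bool_def sum.If_cases Int_def)
  ultimately have v: "(\<Sum>t=1..N. of_bool (q ^ t dvd Suc n)) = ?v"
    by metis
  have "(\<Sum>t=1..N. Suc n div q ^ t) = (\<Sum>t=1..N. n div q ^ t + of_bool (q ^ t dvd Suc n))"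
    by (rule sum.cong) (auto simp: div_Suc dvd_eq_mod_eq_0)
  also have "\<dots> = fact_val n + ?v"
    unfolding sum.distrib v using Suc by simp
  finally show ?case
    by (simp add: fact_val_Suc del: fact_Suc)
qed simp

lemma fact_val_prime_power: "fact_val (q ^ n) = geom q n"
proof -
  have "fact_val (q ^ n) = (\<Sum>t=1..n. q ^ n div q ^ t)"
    using prime_gt_1_nat[OF prime_q] by (intro legendre_fact) simp
  also have "\<dots> = (\<Sum>t=1..n. q ^ (n - t))"
    using prime_gt_0_nat[OF prime_q] by (intro sum.cong) (auto simp: power_diff)
  also have "\<dots> = geom q n"
    by (rule geom_eq[symmetric])
  finally show ?thesis .
qed

lemma div_power_mult_le:
  assumes "t \<le> n"
  shows "c div q ^ t * q ^ n \<le> c * q ^ (n - t)"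
proof -
  have "c div q ^ t * q ^ n = (c div q ^ t * q ^ t) * q ^ (n - t)"
    using power_add[of q t "n - t"] assms by simp
  also have "\<dots> \<le> c * q ^ (n - t)"
    by (intro mult_le_mono1) simp
  finally show ?thesis .
qed

text \<open>Only \<open>n\<close> floors of Legendre's formula remain, each at most its quotient. So
  the chord of \<open>fact_val\<close> from 0 to \<open>c\<close> is no steeper than the one to
  \<open>q ^ n\<close>.\<close>

lemma fact_val_le:
  assumes "c < q ^ Suc n"
  shows "fact_val c * q ^ n \<le> c * geom q n"
  unfolding legendre_fact[OF assms] geom_eq sum_distrib_left sum_distrib_right
  by (intro sum_mono div_power_mult_le) simp

text \<open>Strictness comes from the term \<open>t = k\<close>, whose floor is 0 while
  \<open>c\<close> is positive.\<close>

lemma fact_val_less: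
  assumes "0 < c" "c < q ^ k"
  shows "fact_val c * q ^ k < c * geom q k"
proof -
  have "0 < k"
    using assms by (cases k) auto
  have "c < q ^ Suc k"
    using assms(2) prime_gt_0_nat[OF prime_q] by (simp add: less_le_trans)
  then show ?thesis
    unfolding legendre_fact[OF \<open>c < q ^ Suc k\<close>] geom_eq sum_distrib_left sum_distrib_right
    using assms \<open>0 < k\<close>
    by (intro sum_strict_mono_ex1) (auto intro!: div_power_mult_le bexI[of _ k])
qed

text \<open>Adding a multiple of \<open>q ^ k\<close> does not change the multiplicity of
  \<open>q\<close> in a number strictly between 0 and \<open>q ^ k\<close>.\<close>

lemma fact_val_add:
  assumes "q ^ k dvd a"
  shows "c < q ^ k \<Longrightarrow> fact_val (a + c) = fact_val a + fact_val c"
proof (induction c)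
  case (Suc c)
  have "q ^ t dvd a + Suc c \<longleftrightarrow> q ^ t dvd Suc c" for t
  proof (cases "t \<le> k")
    case True
    then show ?thesis
      using assms by (meson dvd_add_right_iff le_imp_power_dvd dvd_trans)
  next
    case False
    then have "q ^ k dvd q ^ t"
      by (intro le_imp_power_dvd) simp
    moreover have "\<not> q ^ k dvd Suc c"
      using Suc.prems by (auto dest: dvd_imp_le)
    ultimately show ?thesis
      using assms by (meson dvd_add_right_iff dvd_trans)
  qed
  then have "multiplicity q (a + Suc c) = multiplicity q (Suc c)"
    unfolding multiplicity_def by simp
  with Suc show ?case
    by (simp add: fact_val_Suc del: fact_Suc)
qed simp

lemma fact_val_add_ge: "fact_val a + fact_val c \<le> fact_val (a + c)"
proof -
  have "fact a * fact c dvd (fact (a + c) :: nat)"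
    by (rule fact_fact_dvd_fact)
  then have "multiplicity q (fact a * fact c :: nat) \<le> fact_val (a + c)"
    by (intro dvd_imp_multiplicity_le) auto
  moreover have "prime_elem q"
    using prime_q by blast
  then have "multiplicity q (fact a * fact c :: nat) = fact_val a + fact_val c"
    by (rule prime_elem_multiplicity_mult_distrib) simp_all
  ultimately show ?thesis
    by simp
qed

section \<open>The Newton polygon of the truncated exponential at \<open>q\<close>\<close>

lemma pval_fact: "pval q (fact i) = int (fact_val i)"
  using pval_of_nat[OF prime_q, of "fact i"] by simp

text \<open>The valuation of \<open>fact m\<close> is common to all weights and drops out of their
  comparison.\<close>

lemma newton_min_monic_trunc_exp:
  assumes "newton_min q l (monic_trunc_exp m) i"
  shows "i \<le> m" "j \<le> m \<Longrightarrow> l * of_nat i - of_nat (fact_val i) \<le> l * of_nat j - of_nat (fact_val j)"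
proof -
  show i: "i \<le> m"
    using assms by (simp add: newton_min_def coeff_monic_trunc_exp split: if_splits)
  assume "j \<le> m"
  then have "coeff (monic_trunc_exp m) j \<noteq> 0"
    by (simp add: coeff_monic_trunc_exp)
  then have "newton_weight q l (monic_trunc_exp m) i \<le> newton_weight q l (monic_trunc_exp m) j"
    using assms by (simp add: newton_min_def)
  then show "l * of_nat i - of_nat (fact_val i) \<le> l * of_nat j - of_nat (fact_val j)"
    using i \<open>j \<le> m\<close>
    by (simp add: newton_weight_def coeff_monic_trunc_exp pval_divide[OF prime_q] pval_fact)
qed

text \<open>
  An index strictly between two consecutive multiples of \<open>q ^ k\<close> lies strictly above the chord
  joining them.
\<close>
lemma dvd_newton_vertex_trunc_exp:
  assumes i: "newton_min q l (monic_trunc_exp m) i" and "q ^ k dvd m"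
  shows "q ^ k dvd i"
proof (rule ccontr)
  assume not: "\<not> q ^ k dvd i"
  define c a where "c = i mod q ^ k" and "a = i - c"
  have Q: "0 < q ^ k"
    using prime_gt_0_nat[OF prime_q] by simp
  have c: "0 < c" "c < q ^ k" and ia: "i = a + c" and dvd: "q ^ k dvd a"
    using not Q unfolding c_def a_def by (auto simp: dvd_eq_mod_eq_0 minus_mod_eq_mult_div)
  have "i \<le> m"
    using newton_min_monic_trunc_exp(1)[OF i] .
  obtain x y where xy: "m = q ^ k * x" "a = q ^ k * y"
    using assms(2) dvd by (auto elim!: dvdE)
  have "q ^ k * y < q ^ k * x"
    using \<open>i \<le> m\<close> c ia xy by linarith
  then have "y < x"
    using Q by simp
  then have "q ^ k * (y + 1) \<le> q ^ k * x"
    by (intro mult_le_mono2) simp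
  moreover have "a + q ^ k = q ^ k * (y + 1)"
    unfolding xy by simp
  ultimately have m: "a \<le> m" "a + q ^ k \<le> m"
    unfolding xy(1) by linarith+
  have fv: "fact_val (a + c) = fact_val a + fact_val c"
    "fact_val a + geom q k \<le> fact_val (a + q ^ k)"
    using fact_val_add[OF dvd c(2)] fact_val_add_ge[of a "q ^ k"] by (simp_all add: fact_val_prime_power)
  have "l * of_nat i - of_nat (fact_val i) \<le> l * of_nat a - of_nat (fact_val a)"
    using newton_min_monic_trunc_exp(2)[OF i m(1)] .
  then have 1: "l * of_nat c \<le> of_nat (fact_val c)"
    unfolding ia fv by (simp add: algebra_simps)
  have "l * of_nat i - of_nat (fact_val i) \<le> l * of_nat (a + q ^ k) - of_nat (fact_val (a + q ^ k))"
    using newton_min_monic_trunc_exp(2)[OF i m(2)] .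
  moreover have "of_nat (fact_val a) + of_nat (geom q k) \<le> (of_nat (fact_val (a + q ^ k)) :: rat)"
    using fv(2) by (simp only: of_nat_add[symmetric] of_nat_le_iff)
  ultimately have 2: "l * of_nat c - of_nat (fact_val c) \<le> l * of_nat (q ^ k) - of_nat (geom q k)"
    unfolding ia fv(1) by (simp add: algebra_simps)
  have 3: "of_nat (fact_val c) * of_nat (q ^ k) < (of_nat c * of_nat (geom q k) :: rat)"
    using fact_val_less[OF c] by (simp only: of_nat_mult[symmetric] of_nat_less_iff)
  define C K S F :: rat where "C = of_nat c" "K = of_nat (q ^ k)" "S = of_nat (geom q k)" "F = of_nat (fact_val c)"
  have CK: "0 < C" "C < K"
    unfolding C_K_S_F_def using c by (simp_all only: of_nat_0_less_iff of_nat_less_iff)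
  \<comment> \<open>Weighting the two bounds on \<open>l\<close> by \<open>K - C\<close> and
    \<open>C\<close> eliminates \<open>l\<close> and yields
    \<open>C * S \<le> F * K\<close>.\<close>
  have "l * C \<le> F" "S - F \<le> l * (K - C)" "F * K < C * S"
    using 1 2 3 unfolding C_K_S_F_def by (simp_all add: algebra_simps)
  then have "l * C * (K - C) \<le> F * (K - C)" "(S - F) * C \<le> l * (K - C) * C"
    using CK by (simp_all add: mult_right_mono)
  with \<open>F * K < C * S\<close> show False
    by (simp add: algebra_simps)
qed

text \<open>For the largest \<open>n\<close> with \<open>i + q ^ n \<le> m\<close>, comparing
  \<open>i\<close> with \<open>i + q ^ n\<close> bounds \<open>l\<close> from below; a chord at
  \<open>i\<close> shorter than \<open>q ^ Suc n\<close> bounds it from above. Both ends of the edge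
  are multiples of \<open>q ^ k\<close>, whence \<open>k \<le> n\<close>.\<close>

lemma newton_slope_trunc_exp:
  assumes i: "newton_min q l (monic_trunc_exp m) i" and j: "newton_min q l (monic_trunc_exp m) j"
    and "i < j" and "q ^ k dvd m"
  obtains n where "k \<le> n" "l * of_nat (q ^ n) = of_nat (geom q n)"
proof -
  have q1: "1 < q"
    using prime_gt_1_nat[OF prime_q] .
  have jm: "j \<le> m"
    using newton_min_monic_trunc_exp(1)[OF j] .
  have "q ^ k dvd j - i"
    using dvd_newton_vertex_trunc_exp[OF _ assms(4)] i j by (simp add: dvd_diff_nat)
  then have "q ^ k \<le> j - i"
    using \<open>i < j\<close> by (intro dvd_imp_le) auto
  then have k: "i + q ^ k \<le> m"
    using jm \<open>i < j\<close> by linarith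
  define n where "n = Greatest (\<lambda>u. i + q ^ u \<le> m)"
  have bound: "u \<le> m" if "i + q ^ u \<le> m" for u
    using that power_gt_expt[of q u] q1 by linarith
  have n: "i + q ^ n \<le> m" "k \<le> n" and "\<not> i + q ^ Suc n \<le> m"
    using GreatestI_nat[of "\<lambda>u. i + q ^ u \<le> m", OF k] Greatest_le_nat[of "\<lambda>u. i + q ^ u \<le> m"] bound k
    unfolding n_def by (blast, blast, metis not_less_eq_eq order_refl)
  then have n': "m < i + q ^ Suc n"
    by linarith
  define N S :: rat where "N = of_nat (q ^ n)" "S = of_nat (geom q n)"
  have "0 < N"
    using q1 unfolding N_S_def by simp
  have "l * of_nat i - of_nat (fact_val i) \<le> l * of_nat (i + q ^ n) - of_nat (fact_val (i + q ^ n))"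
    using newton_min_monic_trunc_exp(2)[OF i n(1)] .
  moreover have "of_nat (fact_val i) + S \<le> (of_nat (fact_val (i + q ^ n)) :: rat)"
    using fact_val_add_ge[of i "q ^ n"] unfolding N_S_def fact_val_prime_power
    by (simp only: of_nat_add[symmetric] of_nat_le_iff)
  ultimately have ge: "S \<le> l * N"
    unfolding N_S_def by (simp add: algebra_simps)
  have upper: "l * N \<le> S" if "0 < c" "c < q ^ Suc n" "l * of_nat c \<le> of_nat (fact_val c)" for c
  proof -
    have "of_nat (fact_val c) * N \<le> of_nat c * S"
      using fact_val_le[OF that(2)] unfolding N_S_def
      by (simp only: of_nat_mult[symmetric] of_nat_le_iff)
    moreover have "l * of_nat c * N \<le> of_nat (fact_val c) * N"
      using that(3) \<open>0 < N\<close> by (intro mult_right_mono) auto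
    ultimately have "of_nat c * (l * N) \<le> of_nat c * S"
      by (simp add: algebra_simps)
    then show ?thesis
      using that(1) by (simp add: mult_le_cancel_left_pos)
  qed
  \<comment> \<open>The chord runs from \<open>i\<close> to \<open>j\<close> if
    \<open>q ^ Suc n\<close> divides \<open>i\<close>, and otherwise from the preceding multiple of
    \<open>q ^ Suc n\<close> to \<open>i\<close>; either way \<open>fact_val_add\<close> splits the
    valuation.\<close>
  have "l * N \<le> S"
  proof (cases "q ^ Suc n dvd i")
    case True
    have "fact_val j = fact_val i + fact_val (j - i)"
      using fact_val_add[OF True, of "j - i"] n' jm \<open>i < j\<close> by simp
    moreover have "l * of_nat j - of_nat (fact_val j) \<le> l * of_nat i - of_nat (fact_val i)"
      using newton_min_monic_trunc_exp(2)[OF j] newton_min_monic_trunc_exp(1)[OF i] by blast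
    ultimately have "l * of_nat (j - i) \<le> of_nat (fact_val (j - i))"
      using \<open>i < j\<close> by (simp add: of_nat_diff algebra_simps)
    then show ?thesis
      using \<open>i < j\<close> n' jm by (intro upper[of "j - i"]) auto
  next
    case False
    define c a where "c = i mod q ^ Suc n" and "a = i - c"
    have c: "0 < c" "c < q ^ Suc n" and ia: "i = a + c" and dvd: "q ^ Suc n dvd a"
      using False q1 unfolding c_def a_def by (auto simp: dvd_eq_mod_eq_0 minus_mod_eq_mult_div simp del: power_Suc)
    have "l * of_nat i - of_nat (fact_val i) \<le> l * of_nat a - of_nat (fact_val a)"
      using newton_min_monic_trunc_exp(2)[OF i, of a] newton_min_monic_trunc_exp(1)[OF i] ia by simp
    then show ?thesis
      using fact_val_add[OF dvd c(2)] c unfolding ia by (intro upper[of c]) (auto simp: algebra_simps)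
  qed
  with ge n(2) show thesis
    using that[of n] unfolding N_S_def by simp
qed

text \<open>An edge of \<open>g\<close> has the slope of an edge of the product, with reduced
  denominator \<open>q ^ n\<close> and \<open>k \<le> n\<close>. It rises or falls by an integer, so
  its length is a multiple of \<open>q ^ n\<close>.\<close>

lemma prime_power_dvd_degree_factor_trunc_exp:
  assumes gh: "monic_trunc_exp m = g * h" and "q ^ k dvd m"
  shows "q ^ k dvd degree g"
proof (rule dvd_degree_if_dvd_newton_edges[of _ q])
  have "coeff (g * h) 0 \<noteq> 0"
    unfolding gh[symmetric] by (simp add: coeff_monic_trunc_exp)
  then show "coeff g 0 \<noteq> 0"
    by (auto simp: coeff_mult_0)
  have h: "h \<noteq> 0"
    using \<open>coeff (g * h) 0 \<noteq> 0\<close> by auto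
  fix l i j
  assume ij: "newton_min q l g i" "newton_min q l g j" "i < j"
  obtain i' j' where "newton_min q l (g * h) i'" "newton_min q l (g * h) j'" "i' < j'"
    using newton_edge_mult[OF prime_q ij h] .
  then obtain n where n: "k \<le> n" "l * of_nat (q ^ n) = of_nat (geom q n)"
    using newton_slope_trunc_exp[of l m i' j' k] assms by metis
  have nz: "coeff g i \<noteq> 0" "coeff g j \<noteq> 0"
    using ij by (auto simp: newton_min_def)
  have "newton_weight q l g i = newton_weight q l g j"
    using ij nz by (meson newton_min_def antisym)
  then have eq: "l * of_nat (j - i) = of_int (pval q (coeff g i) - pval q (coeff g j))"
    using ij(3) by (simp add: newton_weight_def of_nat_diff algebra_simps)
  have "l * of_nat (q ^ n) * of_nat (j - i) = of_nat (q ^ n) * of_int (pval q (coeff g i) - pval q (coeff g j))"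
    by (simp only: eq[symmetric] mult_ac)
  then have "(of_int (int (geom q n) * int (j - i)) :: rat)
      = of_int (int (q ^ n) * (pval q (coeff g i) - pval q (coeff g j)))"
    unfolding n(2) by simp
  then have "int (geom q n) * int (j - i) = int (q ^ n) * (pval q (coeff g i) - pval q (coeff g j))"
    by (simp only: of_int_eq_iff)
  then have "int (q ^ n) dvd int (geom q n * (j - i))"
    by simp
  then have "q ^ n dvd geom q n * (j - i)"
    by (simp only: of_nat_dvd_iff)
  moreover have "coprime (q ^ n) (geom q n)"
    using coprime_geom[of n q] by (cases "n = 0") (auto simp: coprime_commute)
  ultimately have "q ^ n dvd j - i"
    by (simp add: coprime_dvd_mult_right_iff)
  then show "q ^ k dvd j - i"
    using n(1) by (meson dvd_trans le_imp_power_dvd)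
qed

end

lemma dvd_degree_factor_trunc_exp:
  assumes "monic_trunc_exp m = g * h" "0 < m"
  shows "m dvd degree g"
proof (cases "degree g = 0")
  case False
  show ?thesis
  proof (rule multiplicity_le_imp_dvd)
    fix q :: nat assume q: "prime q"
    have "q ^ multiplicity q m dvd degree g"
      by (rule prime_power_dvd_degree_factor_trunc_exp[OF q assms(1) multiplicity_dvd])
    moreover have "\<not> is_unit q"
      using prime_gt_1_nat[OF q] by simp
    ultimately show "multiplicity q m \<le> multiplicity q (degree g)"
      using False multiplicity_geI by blast
  qed (use assms(2) in simp)
qed simp

text \<open>A factor of positive degree has degree a multiple of \<open>m\<close>, so it takes up
  the whole degree.\<close>

lemma irreducible_monic_trunc_exp:
  assumes "0 < m"
  shows "irreducible (monic_trunc_exp m)"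
proof (rule irreducibleI)
  have M0: "monic_trunc_exp m \<noteq> 0"
    using lead_coeff_monic_trunc_exp[of m] by auto
  then show "monic_trunc_exp m \<noteq> 0" .
  show "\<not> is_unit (monic_trunc_exp m)"
    using assms M0 by (simp add: is_unit_iff_degree degree_monic_trunc_exp)
  fix g h assume gh: "monic_trunc_exp m = g * h"
  then have nz: "g \<noteq> 0" "h \<noteq> 0"
    using M0 by auto
  then have deg: "degree g + degree h = m"
    using arg_cong[OF gh, of degree] by (simp add: degree_mult_eq degree_monic_trunc_exp)
  show "is_unit g \<or> is_unit h"
  proof (cases "degree g = 0")
    case False
    then have "m \<le> degree g"
      using dvd_degree_factor_trunc_exp[OF gh assms] by (simp add: dvd_imp_le)
    then show ?thesis
      using nz deg by (simp add: is_unit_iff_degree)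
  qed (use nz in \<open>simp add: is_unit_iff_degree\<close>)
qed

subsection \<open>Norms of multiplication maps modulo a polynomial\<close>

text \<open>Multiplication by \<open>h\<close> on the quotient modulo \<open>G\<close> in the
  monomial basis; row \<open>i\<close>, not column \<open>i\<close>, holds the image of
  \<open>monom 1 i\<close>.\<close>

definition mult_mat :: "'a::field poly \<Rightarrow> 'a poly \<Rightarrow> 'a mat" where
  "mult_mat G h = mat (degree G) (degree G) (\<lambda>(i, j). coeff ((monom 1 i * h) mod G) j)"

definition poly_norm :: "'a::field poly \<Rightarrow> 'a poly \<Rightarrow> 'a" where
  "poly_norm G h = det (mult_mat G h)"

lemma mult_mat_carrier [simp]: "mult_mat G h \<in> carrier_mat (degree G) (degree G)"
  by (simp add: mult_mat_def)

lemma mod_sum_poly: "(\<Sum>i\<in>A. f i) mod (G :: 'a::field poly) = (\<Sum>i\<in>A. f i mod G)"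
  by (induction A rule: infinite_finite_induct) (simp_all add: poly_mod_add_left)

lemma monom_mod_less: "i < degree G \<Longrightarrow> monom 1 i mod (G :: 'a::field poly) = monom 1 i"
  by (rule mod_poly_less) (simp add: degree_monom_eq)

lemma mult_mat_mult:
  assumes "0 < degree G"
  shows "mult_mat G (g * h) = mult_mat G g * mult_mat G h"
proof (rule eq_matI)
  fix i j assume ij: "i < dim_row (mult_mat G g * mult_mat G h)" "j < dim_col (mult_mat G g * mult_mat G h)"
  then have i: "i < degree G" and j: "j < degree G"
    by (simp_all add: mult_mat_def)
  define u where "u = (monom 1 i * g) mod G"
  have "degree u < degree G"
    using degree_mod_less'[of G "monom 1 i * g"] assms unfolding u_def by fastforce
  then have "degree u \<le> degree G - 1"
    by linarith
  from poly_as_sum_of_monoms'[OF this] have u: "u = (\<Sum>k<degree G. monom (coeff u k) k)"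
    using assms by (simp add: lessThan_Suc_atMost[symmetric])
  have "(monom 1 i * (g * h)) mod G = (u * h) mod G"
    unfolding u_def by (simp add: mod_mult_left_eq mult.assoc)
  also have "u * h = (\<Sum>k<degree G. Polynomial.smult (coeff u k) (monom 1 k * h))"
    by (subst u) (simp add: sum_distrib_right smult_monom flip: mult_smult_left)
  also have "\<dots> mod G = (\<Sum>k<degree G. Polynomial.smult (coeff u k) ((monom 1 k * h) mod G))"
    by (simp add: mod_sum_poly mod_smult_left)
  finally have "coeff ((monom 1 i * (g * h)) mod G) j
      = (\<Sum>k<degree G. coeff u k * coeff ((monom 1 k * h) mod G) j)"
    by (simp add: coeff_sum)
  then show "mult_mat G (g * h) $$ (i, j) = (mult_mat G g * mult_mat G h) $$ (i, j)"
    using i j by (simp add: mult_mat_def scalar_prod_def u_def lessThan_atLeast0)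
qed (simp_all add: mult_mat_def)

lemma poly_norm_mult:
  "0 < degree G \<Longrightarrow> poly_norm G (g * h) = poly_norm G g * poly_norm G h"
  unfolding poly_norm_def by (simp add: mult_mat_mult det_mult[of _ "degree G"])

lemma poly_norm_cong: "g mod G = h mod G \<Longrightarrow> poly_norm G g = poly_norm G h"
  unfolding poly_norm_def mult_mat_def by (metis (no_types, lifting) mod_mult_right_eq)

lemma mult_mat_const: "mult_mat G [:c:] = c \<cdot>\<^sub>m 1\<^sub>m (degree G)"
  by (rule eq_matI) (auto simp: mult_mat_def mod_smult_left monom_mod_less mult.commute[of _ "[:_:]"])

lemma poly_norm_const: "poly_norm G [:c:] = c ^ degree G"
  unfolding poly_norm_def mult_mat_const by simp

lemma poly_norm_1: "poly_norm G 1 = 1"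
  using poly_norm_const[of G 1] by (simp add: one_pCons)

lemma poly_norm_power: "0 < degree G \<Longrightarrow> poly_norm G (h ^ n) = poly_norm G h ^ n"
  by (induction n) (simp_all add: poly_norm_1 poly_norm_mult)

text \<open>Multiplication by \<open>[:z:] - h\<close> has as matrix \<open>z\<close> times the
  identity minus the matrix of \<open>h\<close>.\<close>

lemma poly_char_poly_mult_mat:
  "poly (char_poly (mult_mat G h)) z = poly_norm G ([:z:] - h)"
  unfolding poly_norm_def char_poly_matrix[OF mult_mat_carrier]
proof (rule arg_cong[where f = det], rule eq_matI)
  fix i j assume ij: "i < dim_row (mult_mat G ([:z:] - h))" "j < dim_col (mult_mat G ([:z:] - h))"
  have "monom 1 i * ([:z:] - h) = Polynomial.smult z (monom 1 i) - monom 1 i * h"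
    by (simp add: algebra_simps)
  then show "(- char_matrix (mult_mat G h) z) $$ (i, j) = mult_mat G ([:z:] - h) $$ (i, j)"
    using ij by (simp add: mult_mat_def char_matrix_def poly_mod_diff_left mod_smult_left monom_mod_less)
qed (simp_all add: mult_mat_def char_matrix_def)

section \<open>Eigenvalues over the complex numbers\<close>

lemma map_poly_of_rat_mult:
  "map_poly (of_rat :: rat \<Rightarrow> 'a::field_char_0) (f * g) = map_poly of_rat f * map_poly of_rat g"
  by (rule poly_eqI) (simp add: coeff_map_poly coeff_mult of_rat_sum of_rat_mult)

lemma mult_mat_map_poly:
  "mult_mat (map_poly of_rat G) (map_poly of_rat h) = map_mat (of_rat :: rat \<Rightarrow> complex) (mult_mat G h)"
proof (rule eq_matI)
  fix i j assume ij: "i < dim_row (map_mat (of_rat :: rat \<Rightarrow> complex) (mult_mat G h))"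
    "j < dim_col (map_mat (of_rat :: rat \<Rightarrow> complex) (mult_mat G h))"
  have "map_poly of_rat ((monom 1 i * h) mod G)
      = (monom (1 :: complex) i * map_poly of_rat h) mod map_poly of_rat G"
    by (simp add: of_rat_hom.map_poly_mod map_poly_of_rat_mult map_poly_monom)
  then show "mult_mat (map_poly of_rat G) (map_poly of_rat h) $$ (i, j)
      = map_mat (of_rat :: rat \<Rightarrow> complex) (mult_mat G h) $$ (i, j)"
    using ij by (simp add: mult_mat_def flip: coeff_map_poly)
qed (simp_all add: mult_mat_def)

text \<open>If \<open>G\<close> and \<open>h\<close> were coprime, a Bezout relation would invert
  \<open>h\<close> modulo \<open>G\<close> and its norm would be nonzero. So their gcd is
  nonconstant and has a root.\<close>

lemma common_root_if_poly_norm_0: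
  fixes G h :: "complex poly"
  assumes "0 < degree G" "poly_norm G h = 0"
  obtains b where "poly G b = 0" "poly h b = 0"
proof -
  let ?D = "gcd G h"
  have D0: "?D \<noteq> 0"
    using assms(1) by auto
  have "degree ?D \<noteq> 0"
  proof
    assume "degree ?D = 0"
    then have "is_unit ?D"
      using is_unit_iff_degree[OF D0] by blast
    then have "coprime G h"
      by (rule is_unit_gcd[THEN iffD1])
    then obtain u v where uv: "u * G + v * h = 1"
      by (metis bezout_coefficients_fst_snd coprime_imp_gcd_eq_1)
    have "(v * h) mod G = 1 mod G"
      unfolding uv[symmetric] by simp
    then have "poly_norm G v * poly_norm G h = 1"
      using poly_norm_cong poly_norm_mult[OF assms(1)] poly_norm_1 by metis
    with assms(2) show False
      by simp
  qed
  then obtain b where "poly ?D b = 0"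
    using fundamental_theorem_of_algebra[of ?D] by (auto simp: constant_degree)
  then show thesis
    using that[of b] by (meson dvd_trans gcd_dvd1 gcd_dvd2 poly_eq_0_iff_dvd)
qed

text \<open>Each complex root of the characteristic polynomial is the value of \<open>\<phi>\<close>
  at a root of \<open>G\<close>, hence a root of \<open>M\<close>. The part \<open>R\<close> coprime
  to \<open>M\<close> therefore has no root and is constant.\<close>

lemma char_poly_mult_mat_eq_power:
  fixes G \<phi> M :: "rat poly"
  assumes M: "irreducible M" "lead_coeff M = 1" and G: "0 < degree G" "G dvd pcompose M \<phi>"
  obtains j where "char_poly (mult_mat G \<phi>) = M ^ j"
proof -
  let ?c = "map_poly (of_rat :: rat \<Rightarrow> complex)"
  let ?\<chi> = "char_poly (mult_mat G \<phi>)"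
  have \<chi>: "lead_coeff ?\<chi> = 1"
    using degree_monic_char_poly[OF mult_mat_carrier] by metis
  then have "?\<chi> \<noteq> 0" "\<not> is_unit M"
    using M by (auto simp: irreducible_def)
  then obtain R where R: "?\<chi> = M ^ multiplicity M ?\<chi> * R" "\<not> M dvd R"
    using multiplicity_decompose'[of ?\<chi> M] by blast
  have "lead_coeff R = 1"
    using \<chi> M(2) unfolding arg_cong[OF R(1), of lead_coeff] by (simp add: lead_coeff_mult lead_coeff_power)
  have "coprime M R"
    using M(1) R(2) by (simp add: irreducible_imp_prime_elem_gcd prime_elem_imp_coprime)
  then obtain u v where uv: "u * M + v * R = 1"
    by (metis bezout_coefficients_fst_snd coprime_imp_gcd_eq_1)
  have "degree R = 0"
  proof (rule ccontr)
    assume "degree R \<noteq> 0"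
    then obtain z where z: "poly (?c R) z = 0"
      using fundamental_theorem_of_algebra[of "?c R"] by (auto simp: constant_degree)
    have "poly (?c ?\<chi>) z = 0"
      unfolding arg_cong[OF R(1), of ?c] using z by (simp add: map_poly_of_rat_mult)
    moreover have "?c ?\<chi> = char_poly (mult_mat (?c G) (?c \<phi>))"
      unfolding mult_mat_map_poly by (simp add: of_rat_hom.char_poly_hom[OF mult_mat_carrier])
    ultimately have "poly_norm (?c G) ([:z:] - ?c \<phi>) = 0"
      by (simp add: poly_char_poly_mult_mat)
    moreover have "0 < degree (?c G)"
      using G(1) by simp
    ultimately obtain b where b: "poly (?c G) b = 0" "poly ([:z:] - ?c \<phi>) b = 0"
      using common_root_if_poly_norm_0 by blast
    obtain H where "pcompose M \<phi> = G * H"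
      using G(2) by (elim dvdE)
    then have "?c (pcompose M \<phi>) = ?c G * ?c H"
      by (simp add: map_poly_of_rat_mult)
    then have "poly (pcompose (?c M) (?c \<phi>)) b = 0"
      using b(1) by (simp add: of_rat_hom.map_poly_pcompose)
    then have "poly (?c M) z = 0"
      using b(2) by (simp add: poly_pcompose)
    moreover have "?c u * ?c M + ?c v * ?c R = 1"
      using arg_cong[OF uv, of ?c] by (simp add: map_poly_of_rat_mult of_rat_hom.map_poly_hom_add)
    then have "poly (?c u * ?c M + ?c v * ?c R) z = 1"
      by simp
    ultimately show False
      using z by simp
  qed
  then have "R = 1"
    using \<open>lead_coeff R = 1\<close> by (elim degree_eq_zeroE) (simp add: one_pCons)
  then show thesis
    using that R(1) by simp
qed

section \<open>Determinants and norms modulo \<open>p\<close>\<close>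

context
  fixes p :: nat
  assumes prime_p: "prime p"
begin

lemma vge_prod_ge1:
  assumes "finite A" "a \<in> A" "vge p 1 (g a)" "\<And>i. i \<in> A \<Longrightarrow> vge p 0 (g i)"
  shows "vge p 1 (prod g A)"
proof -
  have "vge p 1 (g a * prod g (A - {a}))"
    using vge_mult[OF prime_p assms(3) vge_prod[OF prime_p, of "A - {a}" g]] assms(4) by simp
  then show ?thesis
    using assms(1,2) by (simp add: prod.remove)
qed

lemma vge_prod_minus_1:
  assumes "\<And>i. i \<in> A \<Longrightarrow> vge p 1 (g i - 1)"
  shows "vge p 1 (prod g A - 1)"
  using assms
proof (induction A rule: infinite_finite_induct)
  case (insert a A)
  have 1: "vge p 1 (g a - 1)" "vge p 1 (prod g A - 1)"
    using insert by auto
  then have "vge p 1 ((g a - 1) * (prod g A - 1))"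
    using vge_mult[OF prime_p 1] vge_mono by (metis one_le_numeral one_add_one)
  then have "vge p 1 ((g a - 1) * (prod g A - 1) + ((g a - 1) + (prod g A - 1)))"
    using 1 by (intro vge_add[OF prime_p])
  moreover have "(g a - 1) * (prod g A - 1) + ((g a - 1) + (prod g A - 1)) = g a * prod g A - 1"
    by (simp add: algebra_simps)
  ultimately show ?case
    unfolding prod.insert[OF insert.hyps] by (simp only:)
qed auto

lemma vge_signof: "vge p 0 (signof \<pi> :: rat)"
  using vge_of_int[OF prime_p, of "signof \<pi>"] by (simp add: sign_def split: if_splits)

lemma vge_det:
  assumes "A \<in> carrier_mat n n" "\<And>i j. i < n \<Longrightarrow> j < n \<Longrightarrow> vge p 0 (A $$ (i, j))"
  shows "vge p 0 (det A)"
  unfolding det_def'[OF assms(1)]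
proof (rule vge_sum[OF prime_p])
  fix \<pi> assume "\<pi> \<in> {\<pi>. \<pi> permutes {0..<n}}"
  then have "vge p 0 (\<Prod>i = 0..<n. A $$ (i, \<pi> i))"
    using assms(2) permutes_in_image by (intro vge_prod[OF prime_p]) fastforce
  then show "vge p 0 (signof \<pi> * (\<Prod>i = 0..<n. A $$ (i, \<pi> i)))"
    using vge_mult[OF prime_p vge_signof, of 0] by simp
qed

text \<open>Every permutation other than the identity meets an off-diagonal entry divisible by
  \<open>p\<close>, so modulo \<open>p\<close> only the diagonal product remains.\<close>

lemma vge_det_minus_1:
  assumes A: "A \<in> carrier_mat n n"
    and vge: "\<And>i j. i < n \<Longrightarrow> j < n \<Longrightarrow> vge p 1 (A $$ (i, j) - of_bool (i = j))"
  shows "vge p 1 (det A - 1)"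
proof -
  let ?t = "\<lambda>\<pi>. signof \<pi> * (\<Prod>i = 0..<n. A $$ (i, \<pi> i))"
  have int: "vge p 0 (A $$ (i, j))" if "i < n" "j < n" for i j
  proof -
    have "vge p 0 (of_bool (i = j))" "vge p 0 (A $$ (i, j) - of_bool (i = j))"
      using vge_1[OF prime_p] vge_mono[OF vge[OF that], of 0] by auto
    from vge_add[OF prime_p this] show ?thesis
      by simp
  qed
  have "det A = ?t id + sum ?t ({\<pi>. \<pi> permutes {0..<n}} - {id})"
    unfolding det_def'[OF A] by (intro sum.remove) (auto simp: finite_permutations permutes_id)
  then have eq: "det A - 1 = ((\<Prod>i = 0..<n. A $$ (i, i)) - 1) + sum ?t ({\<pi>. \<pi> permutes {0..<n}} - {id})"
    by simp
  have "vge p 1 (sum ?t ({\<pi>. \<pi> permutes {0..<n}} - {id}))"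
  proof (rule vge_sum[OF prime_p])
    fix \<pi> assume \<pi>: "\<pi> \<in> {\<pi>. \<pi> permutes {0..<n}} - {id}"
    then have per: "\<pi> permutes {0..<n}" and "\<pi> \<noteq> id"
      by auto
    then obtain i where i: "\<pi> i \<noteq> i"
      by fastforce
    then have "i \<in> {0..<n}"
      using per by (meson permutes_not_in)
    have lt: "\<pi> j < n" if "j < n" for j
      using permutes_in_image[OF per, of j] that by simp
    have "vge p 1 (\<Prod>i = 0..<n. A $$ (i, \<pi> i))"
      using i \<open>i \<in> {0..<n}\<close> lt vge[of i "\<pi> i"] int by (intro vge_prod_ge1[of _ i]) auto
    then show "vge p 1 (?t \<pi>)"
      using vge_mult[OF prime_p vge_signof, of 1] by simp
  qed
  moreover have "vge p 1 ((\<Prod>i = 0..<n. A $$ (i, i)) - 1)"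
    using vge by (intro vge_prod_minus_1) fastforce
  ultimately show ?thesis
    unfolding eq by (intro vge_add[OF prime_p])
qed

lemma vge_poly_norm:
  assumes "lead_coeff G = 1" "poly_vge p 0 G" "poly_vge p 0 (h mod G)"
  shows "vge p 0 (poly_norm G h)"
proof -
  have *: "poly_vge p 0 ((monom 1 i * (h mod G)) mod G)" for i
    using poly_vge_mult[OF prime_p poly_vge_monom[OF prime_p vge_1[OF prime_p]] assms(3)]
    by (intro poly_vge_mod[OF prime_p assms(1,2)]) simp
  show ?thesis
    unfolding poly_norm_def
    by (rule vge_det[OF mult_mat_carrier])
       (use * in \<open>simp add: mult_mat_def poly_vge_def mod_mult_right_eq\<close>)
qed

text \<open>The matrix of multiplication by \<open>1 - h\<close> is the identity modulo
  \<open>p\<close>, so its determinant is 1 modulo \<open>p\<close>.\<close>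

lemma pval_poly_norm_one_minus:
  assumes "lead_coeff G = 1" "poly_vge p 0 G" "poly_vge p 1 (h mod G)"
  shows "poly_norm G (1 - h) \<noteq> 0" "pval p (poly_norm G (1 - h)) = 0"
proof -
  have *: "poly_vge p 1 ((monom 1 i * (h mod G)) mod G)" for i
    using poly_vge_mult[OF prime_p poly_vge_monom[OF prime_p vge_1[OF prime_p]] assms(3)]
    by (intro poly_vge_mod[OF prime_p assms(1,2)]) simp
  have "vge p 1 (poly_norm G (1 - h) - 1)"
    unfolding poly_norm_def
  proof (rule vge_det_minus_1[OF mult_mat_carrier])
    fix i j assume "i < degree G" "j < degree G"
    then have "mult_mat G (1 - h) $$ (i, j) - of_bool (i = j) = - coeff ((monom 1 i * h) mod G) j"
      by (simp add: mult_mat_def right_diff_distrib poly_mod_diff_left monom_mod_less)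
    then show "vge p 1 (mult_mat G (1 - h) $$ (i, j) - of_bool (i = j))"
      using *[of i] by (simp add: vge_minus[OF prime_p] poly_vge_def mod_mult_right_eq)
  qed
  then show "poly_norm G (1 - h) \<noteq> 0" "pval p (poly_norm G (1 - h)) = 0"
    using pval_add_unique[OF prime_p, of 1 "poly_norm G (1 - h) - 1"]
    by (simp_all add: pval_1[OF prime_p])
qed

end

subsection \<open>Elements with power-bounded denominators\<close>

lemma monic_trunc_exp_eq_sum: "monic_trunc_exp m = (\<Sum>i\<le>m. monom (fact m / fact i) i)"
  by (simp add: monic_trunc_exp_def trunc_exp_def smult_sum2 smult_monom)

lemma pcompose_monom: "pcompose (monom c n) f = Polynomial.smult c (f ^ n)"
  for f :: "'a::comm_semiring_1 poly"
  by (induction n) (simp_all add: monom_0 monom_Suc pcompose_pCons)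

text \<open>
  This property replaces integrality over the localization of the integers at \<open>p\<close>: it is
  evidently stable under sums and products, and multiplicativity of the norm makes norms of such
  elements \<open>p\<close>-integral.
\<close>
definition power_bounded :: "nat \<Rightarrow> rat poly \<Rightarrow> rat poly \<Rightarrow> bool" where
  "power_bounded p G z \<longleftrightarrow> (\<exists>c. \<forall>k. poly_vge p (- int c) ((z ^ k) mod G))"

text \<open>
  If \<open>\<alpha>\<close> is a root of \<open>trunc_exp m\<close>, then multiplying the equation by \<open>(p / \<alpha>) ^ m\<close> shows that \<open>p / \<alpha>\<close>
  is a root of this polynomial, which is congruent to \<open>x ^ m\<close> modulo \<open>p\<close>.
\<close>
definition exp_recip :: "nat \<Rightarrow> nat \<Rightarrow> rat poly" where
  "exp_recip p m = (\<Sum>k\<le>m. monom (of_nat p ^ (m - k) / fact (m - k)) k)"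

lemma coeff_exp_recip:
  "coeff (exp_recip p m) k = (if k \<le> m then of_nat p ^ (m - k) / fact (m - k) else 0)"
proof -
  have "coeff (exp_recip p m) k = (\<Sum>j\<le>m. if k = j then of_nat p ^ (m - j) / fact (m - j) else 0)"
    unfolding exp_recip_def coeff_sum coeff_monom by (rule sum.cong) auto
  also have "\<dots> = (if k \<le> m then of_nat p ^ (m - k) / fact (m - k) else 0)"
    by (subst sum.delta') auto
  finally show ?thesis .
qed

lemma degree_exp_recip: "degree (exp_recip p m) = m"
proof (rule antisym)
  show "degree (exp_recip p m) \<le> m"
    by (rule degree_le) (simp add: coeff_exp_recip)
  show "m \<le> degree (exp_recip p m)"
    by (rule le_degree) (simp add: coeff_exp_recip)
qed

lemma lead_coeff_exp_recip: "lead_coeff (exp_recip p m) = 1"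
  by (simp add: degree_exp_recip coeff_exp_recip)

lemma dvd_power_diff: "a - b dvd a ^ n - (b :: 'a::comm_ring_1) ^ n"
  by (simp add: power_diff_sumr2)

text \<open>Here \<open>e\<close> stands for \<open>p / \<phi>\<close>. Modulo \<open>G\<close>,
  each \<open>e ^ m * \<phi> ^ i\<close> becomes \<open>p ^ i * e ^ (m - i)\<close>, and the sum
  read backwards is \<open>fact m\<close> times \<open>exp_recip\<close> at
  \<open>e\<close>.\<close>

lemma dvd_pcompose_exp_recip:
  assumes "G dvd pcompose (monic_trunc_exp m) \<phi>" "G dvd \<phi> * e - [:of_nat p:]"
  shows "G dvd pcompose (exp_recip p m) e"
proof -
  let ?T = "\<lambda>i. Polynomial.smult (fact m / fact i) (([:of_nat p:] ^ i) * e ^ (m - i))"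
  have "e ^ m * pcompose (monic_trunc_exp m) \<phi>
      = (\<Sum>i\<le>m. Polynomial.smult (fact m / fact i) (e ^ m * \<phi> ^ i))"
    by (simp add: monic_trunc_exp_eq_sum pcompose_sum pcompose_monom sum_distrib_left)
  also have "\<dots> = (\<Sum>i\<le>m. Polynomial.smult (fact m / fact i) ((\<phi> * e) ^ i * e ^ (m - i)))"
  proof (rule sum.cong)
    fix i assume "i \<in> {..m}"
    then have "e ^ m = e ^ i * e ^ (m - i)"
      by (simp flip: power_add)
    then show "Polynomial.smult (fact m / fact i) (e ^ m * \<phi> ^ i)
        = Polynomial.smult (fact m / fact i) ((\<phi> * e) ^ i * e ^ (m - i))"
      by (simp add: power_mult_distrib mult_ac)
  qed simp
  finally have eq: "e ^ m * pcompose (monic_trunc_exp m) \<phi>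
      = (\<Sum>i\<le>m. Polynomial.smult (fact m / fact i) ((\<phi> * e) ^ i * e ^ (m - i)))" .
  have "G dvd (\<Sum>i\<le>m. Polynomial.smult (fact m / fact i) ((\<phi> * e) ^ i * e ^ (m - i))) - (\<Sum>i\<le>m. ?T i)"
    unfolding sum_subtractf[symmetric] smult_diff_right[symmetric] left_diff_distrib[symmetric]
    by (intro dvd_sum dvd_smult dvd_mult2 dvd_trans[OF assms(2) dvd_power_diff])
  moreover have "G dvd e ^ m * pcompose (monic_trunc_exp m) \<phi>"
    using assms(1) by simp
  ultimately have "G dvd (\<Sum>i\<le>m. ?T i)"
    unfolding eq by (meson dvd_diffD dvd_diff_commute dvd_diff_right_iff)
  moreover have "(\<Sum>i\<le>m. ?T i) = Polynomial.smult (fact m) (pcompose (exp_recip p m) e)"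
  proof -
    have "(\<Sum>i\<le>m. ?T i) = (\<Sum>k\<le>m. ?T (m - k))"
      by (rule sum.reindex_bij_witness[of _ "\<lambda>t. m - t" "\<lambda>t. m - t"]) auto
    also have "\<dots> = (\<Sum>k\<le>m. Polynomial.smult (fact m) (Polynomial.smult (of_nat p ^ (m - k) / fact (m - k)) (e ^ k)))"
      by (rule sum.cong) (auto simp: poly_const_pow)
    also have "\<dots> = Polynomial.smult (fact m) (pcompose (exp_recip p m) e)"
      by (simp add: exp_recip_def pcompose_sum pcompose_monom smult_sum2)
    finally show ?thesis .
  qed
  ultimately show ?thesis
    by (simp add: dvd_smult_iff)
qed

context
  fixes p :: nat
  assumes prime_p: "prime p"
begin

lemma ex_poly_vge: "\<exists>c. poly_vge p (- int c) f"
proof -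
  have "vge p (- int (\<Sum>i\<le>degree f. nat \<bar>pval p (coeff f i)\<bar>)) (coeff f j)" for j
  proof (cases "j \<le> degree f")
    case True
    then have "nat \<bar>pval p (coeff f j)\<bar> \<le> (\<Sum>i\<le>degree f. nat \<bar>pval p (coeff f i)\<bar>)"
      by (intro member_le_sum) auto
    then show ?thesis
      unfolding vge_def by linarith
  qed (simp add: coeff_eq_0)
  then show ?thesis
    unfolding poly_vge_def by blast
qed

lemma ex_poly_vge_family: fixes n :: nat shows "\<exists>c. \<forall>i<n. poly_vge p (- int c) (f i)"
proof (induction n)
  case (Suc n)
  then obtain c where c: "\<And>i. i < n \<Longrightarrow> poly_vge p (- int c) (f i)"
    by blast
  obtain c' where c': "poly_vge p (- int c') (f n)"
    using ex_poly_vge by blast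
  have "poly_vge p (- int (c + c')) (f i)" if "i < Suc n" for i
    using that c[of i] c' by (cases "i = n") (auto intro: poly_vge_mono)
  then show ?case
    by blast
qed simp

text \<open>As \<open>n < p ^ n\<close>, the strict chord bound applies with exponent
  \<open>n\<close>, and \<open>geom p n \<le> p ^ n\<close> makes its slope at most 1.\<close>

lemma fact_val_less_self:
  assumes "0 < n"
  shows "multiplicity p (fact n :: nat) < n"
proof -
  have "geom p k \<le> p ^ k" for k
  proof (induction k)
    case (Suc k)
    have "geom p (Suc k) \<le> p ^ k + p ^ k"
      using Suc by (simp add: geom_def)
    also have "\<dots> = 2 * p ^ k"
      by simp
    also have "\<dots> \<le> p * p ^ k"
      by (intro mult_le_mono1 prime_ge_2_nat prime_p)
    finally show ?case
      by simp
  qed (simp add: geom_def)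
  then have "n * geom p n \<le> n * p ^ n"
    by (rule mult_le_mono2)
  moreover have "n < p ^ n"
    using prime_gt_1_nat[OF prime_p] by (simp add: power_gt_expt)
  ultimately have "multiplicity p (fact n :: nat) * p ^ n < n * p ^ n"
    using fact_val_less[OF prime_p assms, of n] by linarith
  then show ?thesis
    by simp
qed

text \<open>The valuation is \<open>n\<close> minus the smaller valuation of \<open>fact n\<close>.
  This makes the lower coefficients of \<open>exp_recip\<close> vanish modulo
  \<open>p\<close>.\<close>

lemma vge_power_div_fact:
  assumes "0 < n"
  shows "vge p 1 (of_nat p ^ n / fact n)"
proof -
  have "pval p (of_nat p ^ n / fact n) = int n - int (multiplicity p (fact n :: nat))"
    using prime_gt_0_nat[OF prime_p]
    by (simp add: pval_divide[OF prime_p] pval_power[OF prime_p] pval_p[OF prime_p] pval_fact[OF prime_p])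
  then show ?thesis
    using fact_val_less_self[OF assms] by (simp add: vge_def)
qed

lemma poly_vge_exp_recip: "poly_vge p 0 (exp_recip p m)"
  unfolding poly_vge_def coeff_exp_recip
proof (intro allI)
  fix k
  show "vge p 0 (if k \<le> m then of_nat p ^ (m - k) / fact (m - k) else 0)"
    using vge_power_div_fact[of "m - k"] vge_1[OF prime_p] by (cases "k = m") (auto intro: vge_mono)
qed

lemma poly_vge_monom_minus_exp_recip: "poly_vge p 1 (monom 1 m - exp_recip p m)"
  unfolding poly_vge_def coeff_diff coeff_exp_recip
proof (intro allI)
  fix k
  show "vge p 1 (coeff (monom 1 m) k - (if k \<le> m then of_nat p ^ (m - k) / fact (m - k) else 0))"
    using vge_power_div_fact[of "m - k"] by (cases "k = m") (auto simp: vge_minus[OF prime_p])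
qed

lemma vge_smult_inverse_p: "poly_vge p 1 f \<Longrightarrow> poly_vge p 0 (Polynomial.smult (1 / of_nat p) f)"
proof -
  assume "poly_vge p 1 f"
  moreover have "vge p (- 1) (1 / of_nat p)"
    using prime_gt_0_nat[OF prime_p]
    by (simp add: vge_def pval_divide[OF prime_p] pval_1[OF prime_p] pval_p[OF prime_p])
  ultimately show ?thesis
    using poly_vge_smult[OF prime_p, of "-1" "1 / of_nat p" 1 f] by simp
qed

section \<open>Power-bounded elements modulo a monic integral polynomial\<close>

context
  fixes G :: "rat poly"
  assumes monic: "lead_coeff G = 1" and int: "poly_vge p 0 G"
begin

lemma poly_vge_mult_mod:
  assumes "poly_vge p a (x mod G)" "poly_vge p b (y mod G)"
  shows "poly_vge p (a + b) ((x * y) mod G)"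
  using poly_vge_mod[OF prime_p monic int poly_vge_mult[OF prime_p assms]]
  by (simp add: mod_mult_eq)

lemma power_bounded_integral:
  assumes "poly_vge p 0 z"
  shows "power_bounded p G z"
  unfolding power_bounded_def
  using poly_vge_mod[OF prime_p monic int poly_vge_power[OF prime_p assms]]
  by (intro exI[of _ 0]) simp

lemma power_bounded_mult:
  assumes "power_bounded p G x" "power_bounded p G y"
  shows "power_bounded p G (x * y)"
proof -
  obtain a b where "\<And>k. poly_vge p (- int a) (x ^ k mod G)" "\<And>k. poly_vge p (- int b) (y ^ k mod G)"
    using assms unfolding power_bounded_def by blast
  then have "poly_vge p (- int (a + b)) ((x * y) ^ k mod G)" for k
    using poly_vge_mult_mod[of "- int a" "x ^ k" "- int b" "y ^ k"] by (simp add: power_mult_distrib)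
  then show ?thesis
    unfolding power_bounded_def by blast
qed

text \<open>Binomial coefficients are integers, so every term of the expansion obeys the bound
  \<open>a + b\<close>, whatever \<open>k\<close> is.\<close>

lemma power_bounded_add:
  assumes "power_bounded p G x" "power_bounded p G y"
  shows "power_bounded p G (x + y)"
proof -
  obtain a b where ab: "\<And>k. poly_vge p (- int a) (x ^ k mod G)" "\<And>k. poly_vge p (- int b) (y ^ k mod G)"
    using assms unfolding power_bounded_def by blast
  have "poly_vge p (- int (a + b)) ((x + y) ^ k mod G)" for k
  proof -
    have "poly_vge p (- int (a + b)) ((of_nat (k choose i) * x ^ i * y ^ (k - i)) mod G)" for i
    proof -
      have "poly_vge p 0 (of_nat (k choose i) mod G)"
        using vge_of_int[OF prime_p, of "int (k choose i)"]
        by (intro poly_vge_mod[OF prime_p monic int]) (simp add: of_nat_poly poly_vge_const[OF prime_p])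
      from poly_vge_mult_mod[OF poly_vge_mult_mod[OF this ab(1)] ab(2)] show ?thesis
        by simp
    qed
    then show ?thesis
      unfolding binomial_ring mod_sum_poly by (intro poly_vge_sum[OF prime_p])
  qed
  then show ?thesis
    unfolding power_bounded_def by blast
qed

lemma power_bounded_sum:
  "(\<And>i. i \<in> A \<Longrightarrow> power_bounded p G (f i)) \<Longrightarrow> power_bounded p G (sum f A)"
  by (induction A rule: infinite_finite_induct) (auto intro: power_bounded_add power_bounded_integral)

lemma power_bounded_power: "power_bounded p G x \<Longrightarrow> power_bounded p G (x ^ n)"
  by (induction n) (auto intro: power_bounded_mult power_bounded_integral poly_vge_1[OF prime_p])

lemma power_bounded_pcompose:
  assumes "poly_vge p 0 f" "power_bounded p G x"
  shows "power_bounded p G (pcompose f x)"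
proof -
  have "pcompose f x = (\<Sum>i\<le>degree f. [:coeff f i:] * x ^ i)"
    by (subst poly_as_sum_of_monoms[of f, symmetric]) (simp add: pcompose_sum pcompose_monom)
  moreover have *: "power_bounded p G [:coeff f i:]" for i
    using assms(1) unfolding poly_vge_def[of _ _ f]
    by (intro power_bounded_integral) (simp add: poly_vge_const[OF prime_p])
  ultimately show ?thesis
    by (simp only:) (intro power_bounded_sum power_bounded_mult power_bounded_power assms(2) *)
qed

text \<open>Dividing \<open>monom 1 k\<close> by \<open>L\<close> expresses \<open>x ^ k\<close>
  modulo \<open>G\<close> as an integral combination of powers below \<open>degree L\<close>, and
  these finitely many have a common denominator.\<close>

lemma power_bounded_if_root:
  assumes L: "lead_coeff L = 1" "poly_vge p 0 L" and dvd: "G dvd pcompose L x"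
  shows "power_bounded p G x"
proof -
  obtain c where c: "\<And>i. i < degree L \<Longrightarrow> poly_vge p (- int c) (x ^ i mod G)"
    using ex_poly_vge_family[of "degree L" "\<lambda>i. x ^ i mod G"] by blast
  have "poly_vge p (- int c) (x ^ k mod G)" for k
  proof -
    let ?r = "monom 1 k mod L"
    have r: "poly_vge p 0 ?r"
      using poly_vge_monom[OF prime_p vge_1[OF prime_p]] by (intro poly_vge_mod[OF prime_p L])
    have "pcompose (monom 1 k div L * L + ?r) x = x ^ k"
      unfolding div_mult_mod_eq by (simp add: pcompose_monom)
    then have "x ^ k - pcompose ?r x = pcompose (monom 1 k div L) x * pcompose L x"
      unfolding pcompose_add pcompose_mult by (simp add: algebra_simps)
    then have "G dvd x ^ k - pcompose ?r x"
      using dvd by simp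
    then have "x ^ k mod G = pcompose ?r x mod G"
      by (simp only: mod_eq_dvd_iff)
    also have "pcompose ?r x = (\<Sum>i\<le>degree ?r. Polynomial.smult (coeff ?r i) (x ^ i))"
      by (subst poly_as_sum_of_monoms[of ?r, symmetric]) (simp add: pcompose_sum pcompose_monom)
    also have "poly_vge p (- int c) (\<dots> mod G)"
      unfolding mod_sum_poly mod_smult_left
    proof (rule poly_vge_sum[OF prime_p])
      fix i
      show "poly_vge p (- int c) (Polynomial.smult (coeff ?r i) (x ^ i mod G))"
      proof (cases "coeff ?r i = 0")
        case False
        have "L \<noteq> 0"
          using L(1) by auto
        then have "i < degree L"
          using False degree_mod_less[of L "monom 1 k"] le_degree[OF False] by fastforce
        then show ?thesis
          using poly_vge_smult[OF prime_p _ c, of 0] r by (simp add: poly_vge_def[of _ 0])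
      qed simp
    qed
    finally show ?thesis .
  qed
  then show ?thesis
    unfolding power_bounded_def by blast
qed

text \<open>A norm of negative valuation would give the norms of the powers of \<open>z\<close>
  unbounded denominators, although \<open>p ^ c * z ^ k\<close> is integral modulo
  \<open>G\<close>.\<close>

lemma vge_norm_power_bounded:
  assumes "0 < degree G" "power_bounded p G z"
  shows "vge p 0 (poly_norm G z)"
proof (rule ccontr)
  assume "\<not> vge p 0 (poly_norm G z)"
  then have nz: "poly_norm G z \<noteq> 0" and neg: "pval p (poly_norm G z) \<le> - 1"
    by (auto simp: vge_def)
  obtain c where c: "\<And>k. poly_vge p (- int c) (z ^ k mod G)"
    using assms(2) unfolding power_bounded_def by blast
  \<comment> \<open>The norm of \<open>p ^ c\<close> has valuation \<open>c * degree G\<close>,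
    which \<open>k\<close> exceeds by one.\<close>
  define k where "k = c * degree G + 1"
  have p0: "(of_nat p :: rat) \<noteq> 0"
    using prime_gt_0_nat[OF prime_p] by simp
  have "vge p (int c) (of_nat p ^ c)"
    using p0 by (simp add: vge_def pval_power[OF prime_p] pval_p[OF prime_p])
  from poly_vge_smult[OF prime_p this c[of k]]
  have "poly_vge p 0 (([:of_nat p ^ c:] * z ^ k) mod G)"
    by (simp add: mod_smult_left)
  then have "vge p 0 (poly_norm G ([:of_nat p ^ c:] * z ^ k))"
    by (intro vge_poly_norm[OF prime_p monic int])
  moreover have "poly_norm G ([:of_nat p ^ c:] * z ^ k) = of_nat p ^ (c * degree G) * poly_norm G z ^ k"
    by (simp only: poly_norm_mult[OF assms(1)] poly_norm_const poly_norm_power[OF assms(1)] power_mult)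
  ultimately have "0 \<le> int (c * degree G) + int k * pval p (poly_norm G z)"
    using p0 nz by (simp add: vge_def pval_mult[OF prime_p] pval_power[OF prime_p] pval_p[OF prime_p])
  moreover have "int k * pval p (poly_norm G z) \<le> int k * (- 1)"
    using neg by (intro mult_left_mono) auto
  ultimately show False
    unfolding k_def by simp
qed

text \<open>A high power of \<open>\<eta>\<close> is divisible by \<open>p\<close>, so
  \<open>1 - \<eta> ^ N\<close> has unit norm. It is the product of \<open>1 - \<eta>\<close> and a
  geometric sum, both of integral norm, so both norms are units.\<close>

lemma pval_norm_one_minus_topologically_nilpotent:
  assumes G: "0 < degree G" and \<eta>: "power_bounded p G \<eta>" and \<rho>: "power_bounded p G \<rho>"
    and dvd: "G dvd \<eta> ^ m - [:of_nat p:] * \<rho>"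
  shows "poly_norm G (1 - \<eta>) \<noteq> 0" "pval p (poly_norm G (1 - \<eta>)) = 0"
proof -
  obtain c where c: "\<And>k. poly_vge p (- int c) (\<rho> ^ k mod G)"
    using \<rho> unfolding power_bounded_def by blast
  \<comment> \<open>Of the \<open>Suc c\<close> factors \<open>p\<close>, one is left after clearing
    the denominator of a power of \<open>\<rho>\<close>.\<close>
  define N where "N = m * Suc c"
  have "G dvd \<eta> ^ N - ([:of_nat p:] * \<rho>) ^ Suc c"
    unfolding N_def power_mult using dvd dvd_power_diff dvd_trans by blast
  then have "\<eta> ^ N mod G = ([:of_nat p:] * \<rho>) ^ Suc c mod G"
    by (simp add: mod_eq_dvd_iff)
  also have "([:of_nat p:] * \<rho>) ^ Suc c = Polynomial.smult (of_nat p ^ Suc c) (\<rho> ^ Suc c)"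
    unfolding power_mult_distrib poly_const_pow by simp
  also have "poly_vge p 1 (\<dots> mod G)"
  proof -
    have "vge p (int (Suc c)) (of_nat p ^ Suc c)"
      using prime_gt_0_nat[OF prime_p]
      by (simp add: vge_def pval_power[OF prime_p] pval_p[OF prime_p] del: power_Suc)
    from poly_vge_smult[OF prime_p this c[of "Suc c"]] show ?thesis
      by (simp add: mod_smult_left)
  qed
  finally have N: "poly_vge p 1 (\<eta> ^ N mod G)" .
  have split: "poly_norm G (1 - \<eta> ^ N) = poly_norm G (1 - \<eta>) * poly_norm G (\<Sum>i<N. \<eta> ^ i)"
    unfolding one_diff_power_eq by (rule poly_norm_mult[OF G])
  from pval_poly_norm_one_minus[OF prime_p monic int N]
  have nz: "poly_norm G (1 - \<eta>) \<noteq> 0" "poly_norm G (\<Sum>i<N. \<eta> ^ i) \<noteq> 0"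
    and sum: "pval p (poly_norm G (1 - \<eta>)) + pval p (poly_norm G (\<Sum>i<N. \<eta> ^ i)) = 0"
    unfolding split by (auto simp: pval_mult[OF prime_p])
  have "poly_vge p 0 [:- 1:]"
    using vge_1[OF prime_p] by (simp only: poly_vge_const[OF prime_p] vge_minus[OF prime_p])
  then have "power_bounded p G (1 + [:- 1:] * \<eta>)"
    by (intro power_bounded_add power_bounded_mult \<eta> power_bounded_integral poly_vge_1[OF prime_p])
  then have "power_bounded p G (1 - \<eta>)"
    by simp
  then have "vge p 0 (poly_norm G (1 - \<eta>))"
    by (rule vge_norm_power_bounded[OF G])
  moreover have "power_bounded p G (\<Sum>i<N. \<eta> ^ i)"
    by (intro power_bounded_sum power_bounded_power \<eta>)
  then have "vge p 0 (poly_norm G (\<Sum>i<N. \<eta> ^ i))"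
    by (rule vge_norm_power_bounded[OF G])
  ultimately show "poly_norm G (1 - \<eta>) \<noteq> 0" "pval p (poly_norm G (1 - \<eta>)) = 0"
    using nz sum by (auto simp: vge_def)
qed

end

end

subsection \<open>Factors of the composition\<close>

lemma mult_dvd_degree_factor:
  assumes p: "prime p" and m: "0 < m" and D: "coprime D (multiplicity p (fact m :: nat))"
    and G: "lead_coeff G = 1" "poly_vge p 0 G" "0 < degree G" "G dvd pcompose (monic_trunc_exp m) \<phi>"
    and A: "A \<noteq> 0" "pval p A = 0" and \<phi>: "poly_vge p 1 (\<phi> - monom A D)"
  shows "m * D dvd degree G"
proof -
  let ?M = "monic_trunc_exp m" and ?v = "multiplicity p (fact m :: nat)"
  have p0: "(of_nat p :: rat) \<noteq> 0"
    using prime_gt_0_nat[OF p] by simp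
  obtain Q where Q: "?M = pCons (fact m) Q"
    using coeff_monic_trunc_exp[of m 0] by (cases ?M) (auto simp: coeff_pCons)
  \<comment> \<open>\<open>M = m! + x Q\<close>, so \<open>e\<close> represents \<open>p / \<phi>\<close> modulo \<open>G\<close>\<close>
  define e where "e = Polynomial.smult (- of_nat p / fact m) (pcompose Q \<phi>)"
  define w where "w = Polynomial.smult (1 / of_nat p) (\<phi> - monom A D)"
  \<comment> \<open>As \<open>exp_recip\<close> vanishes at \<open>e\<close> modulo
    \<open>G\<close>, the power \<open>e ^ m\<close> is \<open>p\<close> times \<open>P\<close> at
    \<open>e\<close>. Hence \<open>(e * w) ^ m\<close> is \<open>p * \<rho>\<close> modulo
    \<open>G\<close>.\<close>
  define P where "P = Polynomial.smult (1 / of_nat p) (monom 1 m - exp_recip p m)"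
  define \<rho> where "\<rho> = pcompose P e * w ^ m"
  have "\<phi> * e - [:of_nat p:] = Polynomial.smult (- of_nat p / fact m) (pcompose ?M \<phi>)"
    unfolding e_def Q by (simp add: pcompose_pCons smult_add_right)
  then have e: "G dvd \<phi> * e - [:of_nat p:]"
    using G(4) by (simp add: dvd_smult)
  have root: "G dvd pcompose (exp_recip p m) e"
    by (rule dvd_pcompose_exp_recip[OF G(4) e])
  have pb_e: "power_bounded p G e"
    by (rule power_bounded_if_root[OF p G(1,2) lead_coeff_exp_recip poly_vge_exp_recip[OF p] root])
  have pb_w: "power_bounded p G w"
    unfolding w_def by (intro power_bounded_integral[OF p G(1,2)] vge_smult_inverse_p[OF p] \<phi>)
  have "poly_vge p 0 P"
    unfolding P_def by (intro vge_smult_inverse_p[OF p] poly_vge_monom_minus_exp_recip[OF p])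
  then have pb_\<rho>: "power_bounded p G \<rho>"
    unfolding \<rho>_def
    by (intro power_bounded_mult[OF p G(1,2)] power_bounded_power[OF p G(1,2)]
        power_bounded_pcompose[OF p G(1,2)] pb_e pb_w)
  have "[:of_nat p:] * pcompose P e = e ^ m - pcompose (exp_recip p m) e"
    unfolding P_def using p0 by (simp add: pcompose_smult pcompose_diff pcompose_monom)
  then have "[:of_nat p:] * \<rho> = (e ^ m - pcompose (exp_recip p m) e) * w ^ m"
    unfolding \<rho>_def by (simp only: mult.assoc[symmetric])
  then have "(e * w) ^ m - [:of_nat p:] * \<rho> = pcompose (exp_recip p m) e * w ^ m"
    by (simp add: power_mult_distrib algebra_simps)
  then have "G dvd (e * w) ^ m - [:of_nat p:] * \<rho>"
    using root by simp
  note unit = pval_norm_one_minus_topologically_nilpotent[OF p G(1,2,3)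
      power_bounded_mult[OF p G(1,2) pb_e pb_w] pb_\<rho> this]
  have "\<phi> - monom A D = [:of_nat p:] * w"
    unfolding w_def using p0 by simp
  \<comment> \<open>The element \<open>e * w\<close> is the \<open>\<eta>\<close> of the overview,
    since \<open>\<phi> * e\<close> is \<open>p\<close> modulo \<open>G\<close>.\<close>
  then have "\<phi> * (1 - e * w) - monom A D = - (w * (\<phi> * e - [:of_nat p:]))"
    by (simp add: algebra_simps)
  then have "G dvd \<phi> * (1 - e * w) - monom A D"
    using e by simp
  then have "(\<phi> * (1 - e * w)) mod G = monom A D mod G"
    by (simp only: mod_eq_dvd_iff)
  then have "poly_norm G (\<phi> * (1 - e * w)) = poly_norm G ([:A:] * monom 1 1 ^ D)"
    using poly_norm_cong by (simp add: smult_monom monom_power)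
  then have norm: "poly_norm G \<phi> * poly_norm G (1 - e * w) = A ^ degree G * poly_norm G (monom 1 1) ^ D"
    by (simp only: poly_norm_mult[OF G(3)] poly_norm_const poly_norm_power[OF G(3)])
  obtain j where j: "char_poly (mult_mat G \<phi>) = ?M ^ j"
    using char_poly_mult_mat_eq_power[OF irreducible_monic_trunc_exp[OF m] lead_coeff_monic_trunc_exp G(3,4)] .
  have "degree (char_poly (mult_mat G \<phi>)) = degree G"
    using degree_monic_char_poly[OF mult_mat_carrier] by blast
  moreover have "?M \<noteq> 0"
    using lead_coeff_monic_trunc_exp[of m] by auto
  ultimately have deg: "degree G = m * j"
    by (simp add: j degree_power_eq degree_monic_trunc_exp)
  \<comment> \<open>The characteristic polynomial at 0 is the norm of \<open>- \<phi>\<close>, and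
    \<open>M\<close> has constant term \<open>fact m\<close>.\<close>
  have "poly_norm G ([:0:] - \<phi>) = poly ?M 0 ^ j"
    by (simp only: poly_char_poly_mult_mat[symmetric] j poly_power)
  also have "[:0:] - \<phi> = [:- 1:] * \<phi>"
    by simp
  also have "poly_norm G ([:- 1:] * \<phi>) = (- 1) ^ degree G * poly_norm G \<phi>"
    by (simp only: poly_norm_mult[OF G(3)] poly_norm_const)
  finally have "(- 1) ^ degree G * poly_norm G \<phi> = fact m ^ j"
    by (simp add: Q)
  then have "poly_norm G \<phi> \<in> {fact m ^ j, - (fact m ^ j)}"
    by (cases "even (degree G)") auto
  then have \<phi>0: "poly_norm G \<phi> \<noteq> 0" "pval p (poly_norm G \<phi>) = int j * int ?v"
    by (auto simp: pval_minus[OF p] pval_power[OF p] pval_fact[OF p])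
  have "poly_norm G \<phi> * poly_norm G (1 - e * w) \<noteq> 0"
    using \<phi>0(1) unit(1) by simp
  then have x0: "poly_norm G (monom 1 1) ^ D \<noteq> 0"
    unfolding norm by (metis mult_zero_right)
  \<comment> \<open>Valuations are compared in \<open>norm\<close>, where \<open>A\<close> and the
    norm of \<open>1 - e * w\<close> are units.\<close>
  have "int D * pval p (poly_norm G (monom 1 1)) = pval p (poly_norm G (monom 1 1) ^ D)"
    using x0 by (cases "D = 0") (auto simp: pval_power[OF p] pval_1[OF p])
  also have "\<dots> = pval p (A ^ degree G * poly_norm G (monom 1 1) ^ D)"
    using x0 A by (simp add: pval_mult[OF p] pval_power[OF p])
  also have "\<dots> = int j * int ?v"
    unfolding norm[symmetric] using \<phi>0 unit by (simp add: pval_mult[OF p])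
  finally have "int D dvd int (j * ?v)"
    by (metis dvd_triv_left of_nat_mult)
  then have "D dvd j * ?v"
    by (simp only: of_nat_dvd_iff)
  then have "D dvd j"
    using D by (simp add: coprime_dvd_mult_left_iff)
  then show ?thesis
    unfolding deg by simp
qed

text \<open>A nonconstant monic factor is integral at \<open>p\<close> and its degree is a multiple
  of the full degree \<open>m * D\<close>, so its cofactor is constant.\<close>

lemma irreducible_pcompose_trunc_exp:
  assumes p: "prime p" and m: "0 < m" and D: "coprime D (multiplicity p (fact m :: nat))"
    and D0: "0 < D" and deg: "degree \<phi> = D"
    and A: "A \<noteq> 0" "pval p A = 0" and \<phi>: "poly_vge p 1 (\<phi> - monom A D)"
  shows "irreducible (pcompose (trunc_exp m) \<phi>)"
proof -
  let ?F = "pcompose (monic_trunc_exp m) \<phi>"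
  have F: "?F = Polynomial.smult (fact m) (pcompose (trunc_exp m) \<phi>)"
    by (simp add: monic_trunc_exp_def pcompose_smult)
  have degF: "degree ?F = m * D"
    by (simp add: degree_pcompose degree_monic_trunc_exp deg)
  \<comment> \<open>The leading coefficient is congruent to \<open>A\<close> modulo
    \<open>p\<close>, hence also a unit.\<close>
  have "vge p 1 (lead_coeff \<phi> - A)"
    using \<phi> deg by (auto simp: poly_vge_def dest: spec[of _ D])
  from pval_add_unique[OF p A(1), of "lead_coeff \<phi> - A"] this A(2)
  have lead: "lead_coeff \<phi> \<noteq> 0" "pval p (lead_coeff \<phi>) = 0"
    by simp_all
  have "lead_coeff ?F = lead_coeff \<phi> ^ m"
    using lead_coeff_comp[of \<phi> "monic_trunc_exp m"] deg D0
      lead_coeff_monic_trunc_exp[of m] degree_monic_trunc_exp[of m]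
    by (metis mult_1)
  then have leadF: "pval p (lead_coeff ?F) = 0" "?F \<noteq> 0"
    using lead by (auto simp: pval_power[OF p])
  have "poly_vge p 0 (monic_trunc_exp m)"
    unfolding poly_vge_def
  proof (intro allI)
    fix i
    show "vge p 0 (coeff (monic_trunc_exp m) i)"
    proof (cases "i \<le> m")
      case True
      then have "(fact m / fact i :: rat) = of_int (fact m div fact i)"
        by (simp add: of_int_div fact_dvd)
      then show ?thesis
        using vge_of_int[OF p] by (simp add: coeff_monic_trunc_exp)
    qed (simp add: coeff_monic_trunc_exp)
  qed
  moreover have "poly_vge p 0 \<phi>"
  proof -
    have "vge p 0 A"
      using A by (simp add: vge_def)
    then have "poly_vge p 0 ((\<phi> - monom A D) + monom A D)"
      by (intro poly_vge_add[OF p] poly_vge_mono[OF \<phi>] poly_vge_monom[OF p]) auto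
    then show ?thesis
      by simp
  qed
  ultimately have intF: "poly_vge p 0 ?F"
    by (rule poly_vge_pcompose[OF p])
  show ?thesis
  proof (rule irreducibleI)
    show E0: "pcompose (trunc_exp m) \<phi> \<noteq> 0"
      using leadF(2) F by auto
    have "degree (pcompose (trunc_exp m) \<phi>) = m * D"
      using degF F by simp
    then show "\<not> is_unit (pcompose (trunc_exp m) \<phi>)"
      using E0 m D0 by (simp add: is_unit_iff_degree)
    fix g h assume gh: "pcompose (trunc_exp m) \<phi> = g * h"
    then have nz: "g \<noteq> 0" "h \<noteq> 0"
      using E0 by auto
    show "is_unit g \<or> is_unit h"
    proof (cases "degree g = 0")
      case False
      define G where "G = Polynomial.smult (1 / lead_coeff g) g"
      define H where "H = Polynomial.smult (fact m * lead_coeff g) h"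
      have GH: "?F = G * H"
        unfolding F gh G_def H_def using nz by simp
      have G: "lead_coeff G = 1" "0 < degree G" and "H \<noteq> 0"
        using nz False by (simp_all add: G_def H_def)
      then have "poly_vge p 0 G"
        using monic_factor_integral[OF p, of G H] intF leadF(1) unfolding GH by blast
      then have "m * D dvd degree G"
        using mult_dvd_degree_factor[OF p m D G(1) _ G(2) _ A \<phi>] GH by (metis dvd_triv_left)
      then have "m * D \<le> degree G"
        using G(2) by (rule dvd_imp_le)
      moreover have "degree G + degree H = m * D"
        using degF G(2) \<open>H \<noteq> 0\<close> unfolding GH by (subst (asm) degree_mult_eq) auto
      ultimately have "degree h = 0"
        using nz by (simp add: H_def)
      then show ?thesis
        using nz by (simp add: is_unit_iff_degree)
    qed (use nz in \<open>simp add: is_unit_iff_degree\<close>)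
  qed
qed

section \<open>Iterates of \<open>f\<close> modulo \<open>p\<close>\<close>

lemma poly_vge_power_diff:
  assumes p: "prime p" and "poly_vge p 0 f" "poly_vge p 0 g" "poly_vge p 1 (f - g)"
  shows "poly_vge p 1 (f ^ n - g ^ n)"
proof (induction n)
  case (Suc n)
  have "poly_vge p (0 + 1) (f * (f ^ n - g ^ n))" "poly_vge p (1 + 0) ((f - g) * g ^ n)"
    using assms Suc by (auto intro!: poly_vge_mult[OF p] poly_vge_power[OF p] simp del: add_0 add_0_right)
  then have "poly_vge p 1 (f * (f ^ n - g ^ n) + (f - g) * g ^ n)"
    using poly_vge_add[OF p, of 1] by simp
  then show ?case
    by (simp add: algebra_simps)
qed simp

lemma poly_iterate_0 [simp]: "poly_iterate f 0 = [:0, 1:]"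
  and poly_iterate_Suc [simp]: "poly_iterate f (Suc n) = pcompose f (poly_iterate f n)"
  by (simp_all add: poly_iterate_def)

lemma degree_poly_iterate: "degree (poly_iterate f n) = degree f ^ n"
  for f :: "'a::idom poly"
  by (induction n) (simp_all add: degree_pcompose)

text \<open>Replacing the outer \<open>f\<close> by \<open>monom a d\<close> and then the inner
  iterate by its monomial changes the result only by multiples of \<open>p\<close>.\<close>

lemma poly_iterate_lead_monom:
  assumes p: "prime p" and a: "a \<noteq> 0" "pval p a = 0" and f: "poly_vge p 1 (f - monom a d)"
  shows "\<exists>A. A \<noteq> 0 \<and> pval p A = 0 \<and> poly_vge p 1 (poly_iterate f n - monom A (d ^ n))"
proof (induction n)
  case 0
  then show ?case
    by (intro exI[of _ 1]) (simp add: pval_1[OF p] monom_altdef)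
next
  case (Suc n)
  then obtain A where A: "A \<noteq> 0" "pval p A = 0"
    and \<phi>: "poly_vge p 1 (poly_iterate f n - monom A (d ^ n))" (is "poly_vge p 1 (?\<phi> - ?m)")
    by blast
  have vA: "vge p 0 A" and va: "vge p 0 a"
    using A a by (simp_all add: vge_def)
  then have m: "poly_vge p 0 ?m"
    by (intro poly_vge_monom[OF p])
  have "poly_vge p 0 (?\<phi> - ?m + ?m)"
    by (intro poly_vge_add[OF p] m poly_vge_mono[OF \<phi>]) simp
  then have int: "poly_vge p 0 ?\<phi>"
    by simp
  have "poly_vge p 1 (pcompose (f - monom a d) ?\<phi>)"
    by (rule poly_vge_pcompose[OF p f int])
  moreover have "poly_vge p (0 + 1) (Polynomial.smult a (?\<phi> ^ d - ?m ^ d))"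
    by (intro poly_vge_smult[OF p va] poly_vge_power_diff[OF p int m \<phi>])
  ultimately have "poly_vge p 1 (pcompose (f - monom a d) ?\<phi> + Polynomial.smult a (?\<phi> ^ d - ?m ^ d))"
    using poly_vge_add[OF p] by simp
  \<comment> \<open>The new constant \<open>a * A ^ d\<close> is again a unit, being a product of
    units.\<close>
  moreover have "pcompose (f - monom a d) ?\<phi> + Polynomial.smult a (?\<phi> ^ d - ?m ^ d)
      = poly_iterate f (Suc n) - monom (a * A ^ d) (d ^ Suc n)"
    by (simp add: pcompose_diff pcompose_monom smult_diff_right monom_power smult_monom mult.commute)
  ultimately have "poly_vge p 1 (poly_iterate f (Suc n) - monom (a * A ^ d) (d ^ Suc n))"
    by simp
  moreover have "a * A ^ d \<noteq> 0" "pval p (a * A ^ d) = 0"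
    using A a by (simp_all add: pval_mult[OF p] pval_power[OF p])
  ultimately show ?case
    by blast
qed

text \<open>The valuation of \<open>fact m\<close> is positive because \<open>p \<le> m\<close>, and
  it is less than \<open>m\<close>; so it divides \<open>fact m\<close>, which is coprime to
  \<open>d\<close>.\<close>

lemma coprime_fact_val:
  assumes p: "prime p" "p \<le> m" and d: "coprime d (fact m)"
  shows "coprime d (multiplicity p (fact m :: nat))"
proof -
  let ?v = "multiplicity p (fact m :: nat)"
  have m: "0 < m"
    using prime_gt_0_nat[OF p(1)] p(2) by linarith
  have "p dvd (fact m :: nat)"
    using prime_gt_0_nat[OF p(1)] p(2) by (intro dvd_fact) auto
  then have "0 < ?v"
    using p(1) by (simp add: prime_elem_multiplicity_eq_zero_iff zero_less_iff_neq_zero)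
  then have "?v dvd fact m"
    using fact_val_less_self[OF p(1) m] by (intro dvd_fact) auto
  then show ?thesis
    using d by (rule coprime_divisors[OF dvd_refl])
qed

theorem corollary1p11:
  fixes p m d :: nat and f :: "rat poly"
  assumes "prime p"
    and "m \<ge> 1"
    and "p \<le> m"
    and "degree f = d"
    and "padic_val p (coeff f d) = 0"
    and "cong_lead_monom p f"
    and "coprime d (fact m)"
  shows "dynamically_irreducible_at f (trunc_exp m)"
  unfolding dynamically_irreducible_at_def
proof
  fix n
  note p = assms(1)
  let ?a = "coeff f d"
  have a: "?a \<noteq> 0" "pval p ?a = 0"
    using assms(5) by (auto simp: padic_val_eq zero_extended_def split: if_splits)
  have "poly_vge p 1 (f - monom ?a d)"
    unfolding poly_vge_def
  proof (intro allI)
    fix i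
    consider "i < d" | "i = d" | "i > d"
      by linarith
    then show "vge p 1 (coeff (f - monom ?a d) i)"
    proof cases
      case 1
      then have "padic_val p (coeff f i) > 0"
        using assms(4,6) by (simp add: cong_lead_monom_def)
      with 1 show ?thesis
        by (auto simp: padic_val_eq zero_extended_def vge_def split: if_splits)
    qed (use assms(4) in \<open>auto simp: coeff_eq_0\<close>)
  qed
  then obtain A where A: "A \<noteq> 0" "pval p A = 0"
    and \<phi>: "poly_vge p 1 (poly_iterate f n - monom A (d ^ n))"
    using poly_iterate_lead_monom[OF p a] by blast
  \<comment> \<open>Degree 0 is excluded because \<open>p \<le> m\<close> forces
    \<open>fact m\<close> to be at least 2.\<close>
  have "\<not> coprime 0 (fact m :: nat)"
    using prime_ge_2_nat[OF p] assms(3) fact_ge_self[of m] by simp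
  then have "0 < d"
    using assms(7) by (cases "d = 0") auto
  then show "irreducible (pcompose (trunc_exp m) (poly_iterate f n))"
    using assms(2,4) coprime_fact_val[OF p assms(3,7)]
    by (intro irreducible_pcompose_trunc_exp[OF p _ _ _ _ A \<phi>]) (simp_all add: degree_poly_iterate)
qed

end
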